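(* Let $\vec G_1$ and $\vec G_2$ be orientations of the Coxeter diagrams of finite Coxeter systems $(W_1,S_1)$ and $(W_2,S_2)$. An isomorphism (respectively anti-isomorphism) of directed diagrams $\vec G_1\to\vec G_2$ induces an isomorphism (respectively anti-isomorphism) of Cambrian lattices $\mathcal C(\vec G_1)\to\mathcal C(\vec G_2)$. Conversely, an isomorphism (respectively anti-isomorphism) of Cambrian lattices $\mathcal C(\vec G_1)\to\mathcal C(\vec G_2)$ restricts, on the atoms (which are the classes of the simple reflections, identified with the vertices of the diagrams), to an isomorphism (respectively anti-isomorphism) of directed diagrams.
   Context: The Coxeter diagram of $(W,S)$ has vertex set $S$ with an edge labeled $m(s,t)$ (order of $st$) whenever $m(s,t)>2$. An orientation assigns a direction to each edge. An isomorphism of directed diagrams is a bijection on vertices preserving edges, labels and directions; an anti-isomorphism preserves edges and labels and reverses all directions. The (right) weak order on $W$: $v\le w$ iff $I(v)\subseteq I(w)$, $I(w)$ the set of reflections $t$ with $\ell(tw)<\ell(w)$; it is a lattice for finite $W$. The Cambrian congruence $\Theta(\vec G)$ is the smallest lattice congruence of the weak order such that for each directed edge $s\to t$, $t$ is congruent to the element with reduced word $tsts\cdots$ having $m(s,t)-1$ letters. The Cambrian lattice $\mathcal C(\vec G)$ is the quotient lattice of the weak order modulo $\Theta(\vec G)$.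
   Formalization: An anti-isomorphism sends atoms to coatoms, so it cannot literally restrict to a map of atoms (it fails for A₂); in the anti-isomorphism claims the vertex r of the second diagram is instead identified with the coatom given by the class of r·w₀, where w₀ is the longest element. *)

theory Defs
  imports "HOL-Algebra.Multiplicative_Group"
begin

definition word_eval :: "('a, 'm) monoid_scheme \<Rightarrow> 'a list \<Rightarrow> 'a" where
  "word_eval W ws = foldr (\<lambda>x y. x \<otimes>\<^bsub>W\<^esub> y) ws \<one>\<^bsub>W\<^esub>"

definition cox_m :: "('a, 'm) monoid_scheme \<Rightarrow> 'a \<Rightarrow> 'a \<Rightarrow> nat" where
  "cox_m W s t = group.ord W (s \<otimes>\<^bsub>W\<^esub> t)"

text \<open>Relator words (st)^{m(s,t)} of the Coxeter presentation (s = t gives ss).\<close>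
definition cox_relators :: "('a, 'm) monoid_scheme \<Rightarrow> 'a set \<Rightarrow> 'a list set" where
  "cox_relators W S = {concat (replicate (cox_m W s t) [s, t]) | s t. s \<in> S \<and> t \<in> S}"

inductive rel_step :: "'a list set \<Rightarrow> 'a list \<Rightarrow> 'a list \<Rightarrow> bool" for R where
  "r \<in> R \<Longrightarrow> rel_step R (x @ r @ y) (x @ y)"

text \<open>Equality in the group presented by generators and relators R.\<close>
definition pres_equiv :: "'a list set \<Rightarrow> 'a list \<Rightarrow> 'a list \<Rightarrow> bool" where
  "pres_equiv R = (sup (rel_step R) (rel_step R)\<inverse>\<inverse>)\<^sup>*\<^sup>*"

definition coxeter_system :: "('a, 'm) monoid_scheme \<Rightarrow> 'a set \<Rightarrow> bool" where
  "coxeter_system W S \<longleftrightarrow>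
     group W \<and> S \<subseteq> carrier W \<and> \<one>\<^bsub>W\<^esub> \<notin> S \<and>
     (\<forall>s\<in>S. s \<otimes>\<^bsub>W\<^esub> s = \<one>\<^bsub>W\<^esub>) \<and>
     (\<forall>w\<in>carrier W. \<exists>ws\<in>lists S. word_eval W ws = w) \<and>
     (\<forall>ws\<in>lists S. word_eval W ws = \<one>\<^bsub>W\<^esub> \<longleftrightarrow> pres_equiv (cox_relators W S) ws [])"

definition finite_coxeter_system :: "('a, 'm) monoid_scheme \<Rightarrow> 'a set \<Rightarrow> bool" where
  "finite_coxeter_system W S \<longleftrightarrow> coxeter_system W S \<and> finite (carrier W)"

definition cox_len :: "('a, 'm) monoid_scheme \<Rightarrow> 'a set \<Rightarrow> 'a \<Rightarrow> nat" where
  "cox_len W S w = (LEAST n. \<exists>ws\<in>lists S. length ws = n \<and> word_eval W ws = w)"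

definition reflections :: "('a, 'm) monoid_scheme \<Rightarrow> 'a set \<Rightarrow> 'a set" where
  "reflections W S = {w \<otimes>\<^bsub>W\<^esub> s \<otimes>\<^bsub>W\<^esub> inv\<^bsub>W\<^esub> w | w s. w \<in> carrier W \<and> s \<in> S}"

definition inv_set :: "('a, 'm) monoid_scheme \<Rightarrow> 'a set \<Rightarrow> 'a \<Rightarrow> 'a set" where
  "inv_set W S w = {t \<in> reflections W S. cox_len W S (t \<otimes>\<^bsub>W\<^esub> w) < cox_len W S w}"

text \<open>(Right) weak order: v \<le> w iff I(v) \<subseteq> I(w).\<close>
definition weak_le :: "('a, 'm) monoid_scheme \<Rightarrow> 'a set \<Rightarrow> 'a \<Rightarrow> 'a \<Rightarrow> bool" where
  "weak_le W S v w \<longleftrightarrow> v \<in> carrier W \<and> w \<in> carrier W \<and> inv_set W S v \<subseteq> inv_set W S w"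

definition longest :: "('a, 'm) monoid_scheme \<Rightarrow> 'a set \<Rightarrow> 'a" where
  "longest W S = (THE w. w \<in> carrier W \<and> (\<forall>v\<in>carrier W. cox_len W S v \<le> cox_len W S w))"

definition is_join :: "'x set \<Rightarrow> ('x \<Rightarrow> 'x \<Rightarrow> bool) \<Rightarrow> 'x \<Rightarrow> 'x \<Rightarrow> 'x \<Rightarrow> bool" where
  "is_join A lr x y j \<longleftrightarrow> j \<in> A \<and> lr x j \<and> lr y j \<and> (\<forall>z\<in>A. lr x z \<and> lr y z \<longrightarrow> lr j z)"

definition is_meet :: "'x set \<Rightarrow> ('x \<Rightarrow> 'x \<Rightarrow> bool) \<Rightarrow> 'x \<Rightarrow> 'x \<Rightarrow> 'x \<Rightarrow> bool" where
  "is_meet A lr x y j \<longleftrightarrow> j \<in> A \<and> lr j x \<and> lr j y \<and> (\<forall>z\<in>A. lr z x \<and> lr z y \<longrightarrow> lr z j)"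

definition lattice_congruence :: "'x set \<Rightarrow> ('x \<Rightarrow> 'x \<Rightarrow> bool) \<Rightarrow> 'x rel \<Rightarrow> bool" where
  "lattice_congruence A lr \<Theta> \<longleftrightarrow> equiv A \<Theta> \<and>
     (\<forall>x y z j1 j2. (x, y) \<in> \<Theta> \<longrightarrow> z \<in> A \<longrightarrow> is_join A lr x z j1 \<longrightarrow> is_join A lr y z j2
        \<longrightarrow> (j1, j2) \<in> \<Theta>) \<and>
     (\<forall>x y z j1 j2. (x, y) \<in> \<Theta> \<longrightarrow> z \<in> A \<longrightarrow> is_meet A lr x z j1 \<longrightarrow> is_meet A lr y z j2
        \<longrightarrow> (j1, j2) \<in> \<Theta>)"

definition gen_congruence :: "'x set \<Rightarrow> ('x \<Rightarrow> 'x \<Rightarrow> bool) \<Rightarrow> 'x rel \<Rightarrow> 'x rel" where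
  "gen_congruence A lr P = \<Inter> {\<Theta>. lattice_congruence A lr \<Theta> \<and> P \<subseteq> \<Theta>}"

text \<open>Order of the quotient lattice: X \<le> Y iff X \<or> Y = Y, where X \<or> Y is the class of x \<or> y.\<close>
definition quot_le :: "'x set \<Rightarrow> ('x \<Rightarrow> 'x \<Rightarrow> bool) \<Rightarrow> 'x rel \<Rightarrow> 'x set \<Rightarrow> 'x set \<Rightarrow> bool" where
  "quot_le A lr \<Theta> X Y \<longleftrightarrow> X \<in> A // \<Theta> \<and> Y \<in> A // \<Theta> \<and>
     (\<exists>x\<in>X. \<exists>y\<in>Y. \<exists>j. is_join A lr x y j \<and> j \<in> Y)"

definition order_iso :: "'x set \<Rightarrow> ('x \<Rightarrow> 'x \<Rightarrow> bool) \<Rightarrow> 'y set \<Rightarrow> ('y \<Rightarrow> 'y \<Rightarrow> bool)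
    \<Rightarrow> ('x \<Rightarrow> 'y) \<Rightarrow> bool" where
  "order_iso A lr B lr' f \<longleftrightarrow> bij_betw f A B \<and> (\<forall>x\<in>A. \<forall>y\<in>A. lr x y \<longleftrightarrow> lr' (f x) (f y))"

definition order_anti_iso :: "'x set \<Rightarrow> ('x \<Rightarrow> 'x \<Rightarrow> bool) \<Rightarrow> 'y set \<Rightarrow> ('y \<Rightarrow> 'y \<Rightarrow> bool)
    \<Rightarrow> ('x \<Rightarrow> 'y) \<Rightarrow> bool" where
  "order_anti_iso A lr B lr' f \<longleftrightarrow> bij_betw f A B \<and> (\<forall>x\<in>A. \<forall>y\<in>A. lr x y \<longleftrightarrow> lr' (f y) (f x))"

definition orientation :: "('a, 'm) monoid_scheme \<Rightarrow> 'a set \<Rightarrow> ('a \<times> 'a) set \<Rightarrow> bool" where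
  "orientation W S D \<longleftrightarrow> D \<subseteq> S \<times> S \<and> (\<forall>(s, t)\<in>D. cox_m W s t > 2) \<and>
     (\<forall>s\<in>S. \<forall>t\<in>S. cox_m W s t > 2 \<longrightarrow> ((s, t) \<in> D \<longleftrightarrow> (t, s) \<notin> D))"

definition diagram_iso :: "('a, 'm) monoid_scheme \<Rightarrow> 'a set \<Rightarrow> ('a \<times> 'a) set \<Rightarrow>
    ('b, 'n) monoid_scheme \<Rightarrow> 'b set \<Rightarrow> ('b \<times> 'b) set \<Rightarrow> ('a \<Rightarrow> 'b) \<Rightarrow> bool" where
  "diagram_iso W1 S1 D1 W2 S2 D2 \<phi> \<longleftrightarrow> bij_betw \<phi> S1 S2 \<and>
     (\<forall>s\<in>S1. \<forall>t\<in>S1. (cox_m W1 s t > 2 \<longleftrightarrow> cox_m W2 (\<phi> s) (\<phi> t) > 2) \<and>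
        (cox_m W1 s t > 2 \<longrightarrow> cox_m W2 (\<phi> s) (\<phi> t) = cox_m W1 s t) \<and>
        ((s, t) \<in> D1 \<longleftrightarrow> (\<phi> s, \<phi> t) \<in> D2))"

definition diagram_anti_iso :: "('a, 'm) monoid_scheme \<Rightarrow> 'a set \<Rightarrow> ('a \<times> 'a) set \<Rightarrow>
    ('b, 'n) monoid_scheme \<Rightarrow> 'b set \<Rightarrow> ('b \<times> 'b) set \<Rightarrow> ('a \<Rightarrow> 'b) \<Rightarrow> bool" where
  "diagram_anti_iso W1 S1 D1 W2 S2 D2 \<phi> \<longleftrightarrow> bij_betw \<phi> S1 S2 \<and>
     (\<forall>s\<in>S1. \<forall>t\<in>S1. (cox_m W1 s t > 2 \<longleftrightarrow> cox_m W2 (\<phi> s) (\<phi> t) > 2) \<and>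
        (cox_m W1 s t > 2 \<longrightarrow> cox_m W2 (\<phi> s) (\<phi> t) = cox_m W1 s t) \<and>
        ((s, t) \<in> D1 \<longleftrightarrow> (\<phi> t, \<phi> s) \<in> D2))"

definition alt_elem :: "('a, 'm) monoid_scheme \<Rightarrow> 'a \<Rightarrow> 'a \<Rightarrow> nat \<Rightarrow> 'a" where
  "alt_elem W t s k = word_eval W (map (\<lambda>i. if even i then t else s) [0..<k])"

definition cambrian_cong :: "('a, 'm) monoid_scheme \<Rightarrow> 'a set \<Rightarrow> ('a \<times> 'a) set \<Rightarrow> 'a rel" where
  "cambrian_cong W S D = gen_congruence (carrier W) (weak_le W S)
     {(t, alt_elem W t s (cox_m W s t - 1)) | s t. (s, t) \<in> D}"

definition cambrian_carrier :: "('a, 'm) monoid_scheme \<Rightarrow> 'a set \<Rightarrow> ('a \<times> 'a) set \<Rightarrow> 'a set set" where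
  "cambrian_carrier W S D = carrier W // cambrian_cong W S D"

definition cambrian_le :: "('a, 'm) monoid_scheme \<Rightarrow> 'a set \<Rightarrow> ('a \<times> 'a) set \<Rightarrow> 'a set \<Rightarrow> 'a set \<Rightarrow> bool" where
  "cambrian_le W S D = quot_le (carrier W) (weak_le W S) (cambrian_cong W S D)"

definition cambrian_class :: "('a, 'm) monoid_scheme \<Rightarrow> 'a set \<Rightarrow> ('a \<times> 'a) set \<Rightarrow> 'a \<Rightarrow> 'a set" where
  "cambrian_class W S D w = cambrian_cong W S D `` {w}"

end

theory Submission
  imports Defs
begin

text \<open>
  An (anti-)isomorphism of diagrams extends to the groups by the Coxeter presentation, is an
  isomorphism of weak orders, and matches the generators of the Cambrian congruences. For
  anti-isomorphisms one composes with the anti-automorphism \<open>w \<mapsto> w w0\<close>. It matches the generators for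
  an orientation with those for the opposite one, because with the longest element \<open>w\<close> of the
  dihedral subgroup of \<open>s, t\<close>, joining with \<open>w w0\<close> translates the bottom polygon at \<open>s, t\<close> to the
  top one.

  Conversely, the diagram can be read off the lattice. Projection to the parabolic subgroup
  \<open>\<langle>s, t\<rangle>\<close> is a lattice homomorphism of the weak order, which pulls back to \<open>W\<close> the congruence
  of the polygon that contracts one side only. Whether a simple reflection is an inversion of \<open>w\<close>
  depends only on the class of \<open>w\<close> as well. Hence the atoms are the classes of the simple
  reflections, and for \<open>s \<rightarrow> t\<close> the interval from the class of \<open>s\<close> to its join with that
  of \<open>t\<close> has \<open>m(s,t)\<close> elements, whereas the one from the class of \<open>t\<close> has two.
\<close>

section \<open>Lattice congruences\<close>

text \<open>The delicate point is to bound a generated congruence from above.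
  \<open>cambrian_cong\<close> is a least congruence, so two elements are shown to be incongruent by
  exhibiting another lattice congruence that contains all generators and separates them.
  \<open>simple_congruence\<close> and \<open>side_congruence\<close> are these witnesses; a
  generator for an edge other than \<open>{s, t}\<close> lies in the second one because reflections
  common to the two dihedral subgroups are simple.

  All this is done with inversion sets. Their definition by length says little about products, so
  \<open>refl_parity\<close> counts the occurrences of a reflection along a word. The parity is
  invariant under the relators, hence depends on the element only, and it yields the cocycle rule:
  \<open>N (u v)\<close> is the symmetric difference of \<open>N u\<close> and the conjugate of
  \<open>N v\<close> by \<open>u\<close>. From it follow the injectivity of \<open>N\<close>, the
  projections to parabolic subgroups, and \<open>N (w w0) = T - N w\<close>, which makes right
  multiplication by \<open>w0\<close> an anti-automorphism.\<close>

lemma lattice_congruenceD: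
  assumes "lattice_congruence A lr \<Theta>"
  shows "equiv A \<Theta>"
    and "(x, y) \<in> \<Theta> \<Longrightarrow> z \<in> A \<Longrightarrow> is_join A lr x z j \<Longrightarrow> is_join A lr y z k \<Longrightarrow> (j, k) \<in> \<Theta>"
    and "(x, y) \<in> \<Theta> \<Longrightarrow> z \<in> A \<Longrightarrow> is_meet A lr x z j \<Longrightarrow> is_meet A lr y z k \<Longrightarrow> (j, k) \<in> \<Theta>"
  using assms unfolding lattice_congruence_def by blast+

lemma lattice_congruenceI:
  assumes "equiv A \<Theta>"
    and "\<And>x y z j k. (x, y) \<in> \<Theta> \<Longrightarrow> z \<in> A \<Longrightarrow> is_join A lr x z j \<Longrightarrow> is_join A lr y z k \<Longrightarrow> (j, k) \<in> \<Theta>"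
    and "\<And>x y z j k. (x, y) \<in> \<Theta> \<Longrightarrow> z \<in> A \<Longrightarrow> is_meet A lr x z j \<Longrightarrow> is_meet A lr y z k \<Longrightarrow> (j, k) \<in> \<Theta>"
  shows "lattice_congruence A lr \<Theta>"
  using assms unfolding lattice_congruence_def by blast

text \<open>If \<open>lr x y\<close>, then \<open>y\<close> itself is a join of the two, so the join
  in \<open>quot_le\<close> can be replaced by comparable representatives.\<close>

lemma quot_le_iff:
  assumes "equiv A \<Theta>" "\<And>x. x \<in> A \<Longrightarrow> lr x x"
  shows "quot_le A lr \<Theta> X Y \<longleftrightarrow> X \<in> A // \<Theta> \<and> Y \<in> A // \<Theta> \<and> (\<exists>x\<in>X. \<exists>y\<in>Y. lr x y)"
proof (cases "X \<in> A // \<Theta> \<and> Y \<in> A // \<Theta>")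
  case True
  then have "Y \<subseteq> A" using assms(1) in_quotient_imp_subset by blast
  then show ?thesis using True assms(2) unfolding quot_le_def is_join_def by blast
qed (auto simp: quot_le_def)

lemma lattice_congruence_top: "lattice_congruence A lr (A \<times> A)"
  by (auto simp: lattice_congruence_def is_join_def is_meet_def equiv_def refl_on_def sym_def trans_def)

text \<open>The family that is intersected is nonempty since \<open>A \<times> A\<close> is a
  congruence; this is where \<open>P\<close> has to lie inside \<open>A \<times> A\<close>.\<close>

lemma gen_congruence:
  assumes "P \<subseteq> A \<times> A"
  shows "lattice_congruence A lr (gen_congruence A lr P)" "P \<subseteq> gen_congruence A lr P"
proof -
  let ?F = "{\<Theta>. lattice_congruence A lr \<Theta> \<and> P \<subseteq> \<Theta>}"
  have top: "A \<times> A \<in> ?F" using assms lattice_congruence_top by blast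
  have e: "equiv A \<Theta>" if "\<Theta> \<in> ?F" for \<Theta> using that lattice_congruenceD(1) by blast
  have "equiv A (\<Inter> ?F)"
  proof (rule equivI)
    show "\<Inter> ?F \<subseteq> A \<times> A" using top by blast
    show "refl_on A (\<Inter> ?F)" using e unfolding equiv_def refl_on_def by blast
    show "sym (\<Inter> ?F)" using e unfolding equiv_def sym_def by blast
    show "trans (\<Inter> ?F)" using e unfolding equiv_def trans_def by blast
  qed
  then show "lattice_congruence A lr (gen_congruence A lr P)"
    unfolding gen_congruence_def
  proof (rule lattice_congruenceI)
    show "(j, k) \<in> \<Inter> ?F"
      if "(x, y) \<in> \<Inter> ?F" "z \<in> A" "is_join A lr x z j" "is_join A lr y z k" for x y z j k
      using that(1) lattice_congruenceD(2)[OF _ _ that(2-4)] by blast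
    show "(j, k) \<in> \<Inter> ?F"
      if "(x, y) \<in> \<Inter> ?F" "z \<in> A" "is_meet A lr x z j" "is_meet A lr y z k" for x y z j k
      using that(1) lattice_congruenceD(3)[OF _ _ that(2-4)] by blast
  qed
  show "P \<subseteq> gen_congruence A lr P" unfolding gen_congruence_def by blast
qed

lemma gen_congruence_least:
  "lattice_congruence A lr \<Theta> \<Longrightarrow> P \<subseteq> \<Theta> \<Longrightarrow> gen_congruence A lr P \<subseteq> \<Theta>"
  unfolding gen_congruence_def by blast

text \<open>Meeting both members of \<open>(x, y)\<close> with \<open>z\<close> leaves
  \<open>x\<close> fixed and turns \<open>y\<close> into \<open>z\<close>.\<close>

lemma congruence_convex:
  assumes "lattice_congruence A lr \<Theta>" "\<And>x. x \<in> A \<Longrightarrow> lr x x"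
    "(x, y) \<in> \<Theta>" "x \<in> A" "z \<in> A" "lr x z" "lr z y"
  shows "(x, z) \<in> \<Theta>"
  by (rule lattice_congruenceD(3)[OF assms(1,3,5)]) (use assms in \<open>auto simp: is_meet_def\<close>)

lemma order_iso_join_meet:
  assumes f: "order_iso A lr B lr' f" and "x \<in> A" "y \<in> A"
  shows "is_join A lr x y j \<Longrightarrow> is_join B lr' (f x) (f y) (f j)"
    and "is_meet A lr x y j \<Longrightarrow> is_meet B lr' (f x) (f y) (f j)"
  using assms unfolding order_iso_def is_join_def is_meet_def bij_betw_def by (blast | fastforce)+

lemma lattice_congruence_pullback:
  assumes f: "order_iso A lr B lr' f" and \<Theta>: "lattice_congruence B lr' \<Theta>"
  shows "lattice_congruence A lr {(x, y). x \<in> A \<and> y \<in> A \<and> (f x, f y) \<in> \<Theta>}" (is "lattice_congruence A lr ?K")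
proof (rule lattice_congruenceI)
  have fA: "x \<in> A \<Longrightarrow> f x \<in> B" for x using f unfolding order_iso_def bij_betw_def by blast
  show "equiv A ?K"
  proof (rule equivI)
    have e: "equiv B \<Theta>" using \<Theta> lattice_congruenceD(1) by blast
    show "refl_on A ?K" using e fA unfolding equiv_def refl_on_def by blast
    show "sym ?K" using e unfolding equiv_def sym_def by blast
    show "trans ?K" using e unfolding equiv_def trans_def by blast
  qed blast
  show "(j, k) \<in> ?K" if "(x, y) \<in> ?K" "z \<in> A" "is_join A lr x z j" "is_join A lr y z k" for x y z j k
    using that order_iso_join_meet(1)[OF f] lattice_congruenceD(2)[OF \<Theta>, of "f x" "f y" "f z" "f j" "f k"] fA
    unfolding is_join_def[of A] by auto
  show "(j, k) \<in> ?K" if "(x, y) \<in> ?K" "z \<in> A" "is_meet A lr x z j" "is_meet A lr y z k" for x y z j k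
    using that order_iso_join_meet(2)[OF f] lattice_congruenceD(3)[OF \<Theta>, of "f x" "f y" "f z" "f j" "f k"] fA
    unfolding is_meet_def[of A] by auto
qed

text \<open>By leastness it is enough that \<open>f\<close> and \<open>g\<close> send generators
  into the generated congruences: the two pullbacks then contain \<Theta> and \<Psi>, which gives
  both directions of \<open>iff\<close>. The orders are arbitrary, so the lemma also serves with one
  of them reversed.\<close>

lemma quotient_order_iso:
  assumes f: "order_iso A lr B lr' f" and g: "order_iso B lr' A lr g"
    and fg: "\<And>y. y \<in> B \<Longrightarrow> f (g y) = y"
    and rA: "\<And>x. x \<in> A \<Longrightarrow> lr x x" and rB: "\<And>y. y \<in> B \<Longrightarrow> lr' y y"
    and P: "P \<subseteq> A \<times> A" and Q: "Q \<subseteq> B \<times> B"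
    and fP: "\<And>x y. (x, y) \<in> P \<Longrightarrow> (f x, f y) \<in> gen_congruence B lr' Q"
    and gQ: "\<And>x y. (x, y) \<in> Q \<Longrightarrow> (g x, g y) \<in> gen_congruence A lr P"
  defines "\<Theta> \<equiv> gen_congruence A lr P" and "\<Psi> \<equiv> gen_congruence B lr' Q"
  shows "order_iso (A // \<Theta>) (quot_le A lr \<Theta>) (B // \<Psi>) (quot_le B lr' \<Psi>) (\<lambda>X. f ` X)"
    and "x \<in> A \<Longrightarrow> f ` (\<Theta> `` {x}) = \<Psi> `` {f x}"
proof -
  note gP = gen_congruence[OF P, of lr, folded \<Theta>_def] and gQ' = gen_congruence[OF Q, of lr', folded \<Psi>_def]
  have eA: "equiv A \<Theta>" and eB: "equiv B \<Psi>" using gP(1) gQ'(1) lattice_congruenceD(1) by blast+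
  have bf: "bij_betw f A B" using f unfolding order_iso_def by blast
  have bg: "bij_betw g B A" using g unfolding order_iso_def by blast
  have gf: "g (f x) = x" if "x \<in> A" for x
    using that fg bf bg by (metis bij_betw_apply bij_betw_inv_into_left)
  have "\<Theta> \<subseteq> {(x, y). x \<in> A \<and> y \<in> A \<and> (f x, f y) \<in> \<Psi>}"
    unfolding \<Theta>_def
    by (rule gen_congruence_least[OF lattice_congruence_pullback[OF f gQ'(1)]]) (use P fP \<Psi>_def in auto)
  moreover have "\<Psi> \<subseteq> {(x, y). x \<in> B \<and> y \<in> B \<and> (g x, g y) \<in> \<Theta>}"
    unfolding \<Psi>_def
    by (rule gen_congruence_least[OF lattice_congruence_pullback[OF g gP(1)]]) (use Q gQ \<Theta>_def in auto)
  ultimately have iff: "(x, y) \<in> \<Theta> \<longleftrightarrow> (f x, f y) \<in> \<Psi>" if "x \<in> A" "y \<in> A" for x y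
    using gf that by fastforce
  have sub: "\<Theta> \<subseteq> A \<times> A" "\<Psi> \<subseteq> B \<times> B" using eA eB by (simp_all add: equiv_type)
  show cls: "f ` (\<Theta> `` {x}) = \<Psi> `` {f x}" if x: "x \<in> A" for x
  proof
    show "f ` (\<Theta> `` {x}) \<subseteq> \<Psi> `` {f x}" using iff sub x by auto
    show "\<Psi> `` {f x} \<subseteq> f ` (\<Theta> `` {x})"
    proof
      fix y assume y: "y \<in> \<Psi> `` {f x}"
      then have "y \<in> B" using sub by auto
      then have gy: "g y \<in> A" "f (g y) = y" using bg fg bij_betw_apply by metis+
      then have "(x, g y) \<in> \<Theta>" using iff[of x "g y"] y x by simp
      then show "y \<in> f ` (\<Theta> `` {x})" using gy by (metis Image_singleton_iff image_eqI)
    qed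
  qed
  have q: "B // \<Psi> = (\<lambda>X. f ` X) ` (A // \<Theta>)"
  proof -
    have "B // \<Psi> = (\<lambda>y. \<Psi> `` {y}) ` f ` A"
      using bf unfolding quotient_def bij_betw_def by auto
    also have "\<dots> = (\<lambda>x. f ` (\<Theta> `` {x})) ` A" using cls by (simp add: image_image)
    also have "\<dots> = (\<lambda>X. f ` X) ` (A // \<Theta>)" unfolding quotient_def by auto
    finally show ?thesis .
  qed
  have subA: "X \<subseteq> A" if "X \<in> A // \<Theta>" for X using that eA in_quotient_imp_subset by blast
  have "inj_on (\<lambda>X. f ` X) (A // \<Theta>)"
    using inj_on_image_eq_iff bf subA unfolding inj_on_def bij_betw_def
    by (metis (no_types, lifting) inj_on_def)
  then have bij: "bij_betw (\<lambda>X. f ` X) (A // \<Theta>) (B // \<Psi>)" using q by (simp add: bij_betw_def)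
  have "quot_le A lr \<Theta> X Y \<longleftrightarrow> quot_le B lr' \<Psi> (f ` X) (f ` Y)"
    if "X \<in> A // \<Theta>" "Y \<in> A // \<Theta>" for X Y
  proof -
    have "lr x y \<longleftrightarrow> lr' (f x) (f y)" if "x \<in> X" "y \<in> Y" for x y
      using f subA \<open>X \<in> _\<close> \<open>Y \<in> _\<close> that unfolding order_iso_def by blast
    then show ?thesis using that q
      quot_le_iff[of A \<Theta> lr X Y] quot_le_iff[of B \<Psi> lr' "f ` X" "f ` Y"] eA eB rA rB by auto
  qed
  with bij show "order_iso (A // \<Theta>) (quot_le A lr \<Theta>) (B // \<Psi>) (quot_le B lr' \<Psi>) (\<lambda>X. f ` X)"
    unfolding order_iso_def by blast
qed

lemma order_anti_iso_converse:
  "order_anti_iso A lr B lr' f \<longleftrightarrow> order_iso A lr B (\<lambda>x y. lr' y x) f"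
  unfolding order_iso_def order_anti_iso_def by simp

text \<open>Reversal swaps joins and meets, and the definition of a congruence treats the two
  alike.\<close>

lemma gen_congruence_converse: "gen_congruence A (\<lambda>x y. lr y x) P = gen_congruence A lr P"
proof -
  have "is_join A (\<lambda>x y. lr y x) = is_meet A lr" "is_meet A (\<lambda>x y. lr y x) = is_join A lr"
    unfolding is_join_def is_meet_def by auto
  then have "lattice_congruence A (\<lambda>x y. lr y x) = lattice_congruence A lr"
    unfolding lattice_congruence_def by (intro ext) auto
  then show ?thesis by (simp add: gen_congruence_def)
qed

text \<open>\<open>quot_le\<close> is phrased with joins, so duality is not visible in its
  definition; it is in the form given by \<open>quot_le_iff\<close>.\<close>

lemma quot_le_converse:
  assumes "equiv A \<Theta>" "\<And>x. x \<in> A \<Longrightarrow> lr x x"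
  shows "quot_le A (\<lambda>x y. lr y x) \<Theta> X Y \<longleftrightarrow> quot_le A lr \<Theta> Y X"
  using quot_le_iff[of A \<Theta> "\<lambda>x y. lr y x" X Y] quot_le_iff[of A \<Theta> lr Y X] assms by auto

lemma order_iso_inverse:
  assumes "order_iso A lr B lr' f"
  shows "order_iso B lr' A lr (inv_into A f)"
proof -
  have b: "bij_betw f A B" using assms unfolding order_iso_def by blast
  then have "f (inv_into A f y) = y" "inv_into A f y \<in> A" if "y \<in> B" for y
    using that by (auto simp: bij_betw_inv_into_right bij_betw_def inv_into_into)
  then show ?thesis using assms bij_betw_inv_into[OF b] unfolding order_iso_def by metis
qed

lemma order_iso_comp:
  assumes "order_iso A lr B lr' f" "order_iso B lr' C lr'' g"
  shows "order_iso A lr C lr'' (g \<circ> f)"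
  using assms bij_betw_trans[of f A B g C] unfolding order_iso_def by (auto simp: bij_betw_apply)

section \<open>Bottom, atoms and sides as order invariants\<close>

definition bottom_of :: "'x set \<Rightarrow> ('x \<Rightarrow> 'x \<Rightarrow> bool) \<Rightarrow> 'x \<Rightarrow> bool" where
  "bottom_of A lr x \<longleftrightarrow> x \<in> A \<and> (\<forall>z\<in>A. lr x z)"

definition atom_of :: "'x set \<Rightarrow> ('x \<Rightarrow> 'x \<Rightarrow> bool) \<Rightarrow> 'x \<Rightarrow> bool" where
  "atom_of A lr x \<longleftrightarrow> x \<in> A \<and> \<not> bottom_of A lr x \<and> (\<forall>z\<in>A. lr z x \<longrightarrow> bottom_of A lr z \<or> z = x)"

text \<open>The interval from \<open>x\<close> to the join of \<open>x\<close> and \<open>y\<close>, in a form that does not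
  presuppose that the join exists.\<close>
definition side :: "'x set \<Rightarrow> ('x \<Rightarrow> 'x \<Rightarrow> bool) \<Rightarrow> 'x \<Rightarrow> 'x \<Rightarrow> 'x set" where
  "side A lr x y = {z \<in> A. lr x z \<and> (\<forall>v\<in>A. lr x v \<and> lr y v \<longrightarrow> lr z v)}"

lemma order_iso_bottom:
  assumes "order_iso A lr B lr' f" "x \<in> A"
  shows "bottom_of B lr' (f x) \<longleftrightarrow> bottom_of A lr x"
  using assms unfolding order_iso_def bottom_of_def bij_betw_def by auto

lemma order_iso_atom:
  assumes "order_iso A lr B lr' f" "x \<in> A"
  shows "atom_of B lr' (f x) \<longleftrightarrow> atom_of A lr x"
proof -
  have B: "B = f ` A" "inj_on f A" and le: "\<And>x y. x \<in> A \<Longrightarrow> y \<in> A \<Longrightarrow> lr x y \<longleftrightarrow> lr' (f x) (f y)"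
    using assms unfolding order_iso_def bij_betw_def by auto
  have "(\<forall>z\<in>B. lr' z (f x) \<longrightarrow> bottom_of B lr' z \<or> z = f x) \<longleftrightarrow>
      (\<forall>z\<in>A. lr' (f z) (f x) \<longrightarrow> bottom_of B lr' (f z) \<or> f z = f x)"
    unfolding B by auto
  also have "\<dots> \<longleftrightarrow> (\<forall>z\<in>A. lr z x \<longrightarrow> bottom_of A lr z \<or> z = x)"
    using le order_iso_bottom[OF assms(1)] B(2) assms(2) by (auto simp: inj_on_eq_iff)
  finally show ?thesis unfolding atom_of_def
    using order_iso_bottom[OF assms] assms(2) B by auto
qed

lemma order_iso_card_side:
  assumes "order_iso A lr B lr' f" "x \<in> A" "y \<in> A"
  shows "card (side B lr' (f x) (f y)) = card (side A lr x y)"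
proof -
  have B: "B = f ` A" "inj_on f A" and le: "\<And>x y. x \<in> A \<Longrightarrow> y \<in> A \<Longrightarrow> lr x y \<longleftrightarrow> lr' (f x) (f y)"
    using assms unfolding order_iso_def bij_betw_def by auto
  have "side B lr' (f x) (f y) = f ` side A lr x y"
    unfolding side_def B using le assms(2,3) by auto
  moreover have "inj_on f (side A lr x y)"
    using B(2) by (rule inj_on_subset) (auto simp: side_def)
  ultimately show ?thesis by (simp add: card_image)
qed

section \<open>Reflections and inversion sets\<close>

context monoid begin

lemma word_eval_Nil [simp]: "word_eval G [] = \<one>"
  and word_eval_Cons [simp]: "word_eval G (s # ws) = s \<otimes> word_eval G ws"
  by (simp_all add: word_eval_def)

lemma word_eval_closed [simp]: "ws \<in> lists (carrier G) \<Longrightarrow> word_eval G ws \<in> carrier G"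
  by (induction ws) auto

lemma word_eval_append:
  "xs \<in> lists (carrier G) \<Longrightarrow> ys \<in> lists (carrier G) \<Longrightarrow>
    word_eval G (xs @ ys) = word_eval G xs \<otimes> word_eval G ys"
  by (induction xs) (auto simp: m_assoc)

lemma word_eval_power:
  assumes "s \<in> carrier G" "t \<in> carrier G"
  shows "word_eval G (concat (replicate k [s, t])) = (s \<otimes> t) [^] k"
proof (induction k)
  case (Suc k)
  have "(s \<otimes> t) [^] Suc k = s \<otimes> t \<otimes> (s \<otimes> t) [^] k" by (rule nat_pow_Suc2) (use assms in simp)
  with Suc assms show ?case by (simp add: m_assoc del: nat_pow_Suc)
qed simp

end

locale coxeter = group W for W :: "('a, 'm) monoid_scheme" (structure) +
  fixes S :: "'a set"
  assumes coxeter: "coxeter_system W S"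
begin

abbreviation "ev \<equiv> word_eval W"
abbreviation "len \<equiv> cox_len W S"
abbreviation "T \<equiv> reflections W S"
abbreviation "N \<equiv> inv_set W S"

lemma S_carrier: "S \<subseteq> carrier W" and one_notin_S: "\<one> \<notin> S"
  and S_square: "s \<in> S \<Longrightarrow> s \<otimes> s = \<one>"
  and words_onto: "w \<in> carrier W \<Longrightarrow> \<exists>ws\<in>lists S. ev ws = w"
  and presentation: "ws \<in> lists S \<Longrightarrow> ev ws = \<one> \<longleftrightarrow> pres_equiv (cox_relators W S) ws []"
  using coxeter unfolding coxeter_system_def by auto

lemma S_closed [simp]: "s \<in> S \<Longrightarrow> s \<in> carrier W"
  using S_carrier by auto

lemma S_inv [simp]: "s \<in> S \<Longrightarrow> inv s = s"
  by (simp add: S_square inv_equality)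

lemma S_cancel [simp]: "s \<in> S \<Longrightarrow> x \<in> carrier W \<Longrightarrow> s \<otimes> (s \<otimes> x) = x"
  by (metis S_square S_closed l_one m_assoc)

lemma inv_cancel [simp]:
  "g \<in> carrier W \<Longrightarrow> x \<in> carrier W \<Longrightarrow> g \<otimes> (inv g \<otimes> x) = x"
  "g \<in> carrier W \<Longrightarrow> x \<in> carrier W \<Longrightarrow> inv g \<otimes> (g \<otimes> x) = x"
  by (metis inv_closed l_one m_assoc r_inv) (metis inv_closed l_one m_assoc l_inv)

lemma lists_carrier: "J \<subseteq> S \<Longrightarrow> ws \<in> lists J \<Longrightarrow> ws \<in> lists (carrier W)"
  using S_carrier by (meson in_mono lists_mono order_trans)

lemma ev_closed_S [simp]: "ws \<in> lists S \<Longrightarrow> ev ws \<in> carrier W"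
  using lists_carrier[of S] by auto

lemma ev_append_S: "xs \<in> lists S \<Longrightarrow> ys \<in> lists S \<Longrightarrow> ev (xs @ ys) = ev xs \<otimes> ev ys"
  using lists_carrier[of S] by (simp add: word_eval_append)

lemma ev_rev: "xs \<in> lists S \<Longrightarrow> ev (rev xs) = inv (ev xs)"
proof (induction xs)
  case (Cons a xs)
  have "ev (rev xs @ [a]) = ev (rev xs) \<otimes> ev [a]"
    using Cons.prems by (intro ev_append_S) auto
  with Cons show ?case by (auto simp: inv_mult_group)
qed simp

lemma len_word:
  assumes "w \<in> carrier W"
  obtains ws where "ws \<in> lists S" "length ws = len w" "ev ws = w"
proof -
  have "\<exists>n. \<exists>ws\<in>lists S. length ws = n \<and> ev ws = w" using words_onto[OF assms] by auto
  from LeastI_ex[OF this] show ?thesis using that unfolding cox_len_def by blast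
qed

lemma len_le: "ws \<in> lists S \<Longrightarrow> len (ev ws) \<le> length ws"
  unfolding cox_len_def by (rule Least_le) auto

lemma refl_iff: "t \<in> T \<longleftrightarrow> (\<exists>w\<in>carrier W. \<exists>s\<in>S. t = w \<otimes> s \<otimes> inv w)"
  unfolding reflections_def by auto

lemma refl_closed [simp]: "t \<in> T \<Longrightarrow> t \<in> carrier W"
  by (auto simp: refl_iff)

lemma S_refl: "s \<in> S \<Longrightarrow> s \<in> T"
  unfolding refl_iff by (rule bexI[of _ \<one>], rule bexI[of _ s]) auto

lemma refl_square: "t \<in> T \<Longrightarrow> t \<otimes> t = \<one>"
  by (auto simp: refl_iff m_assoc)

lemma refl_conj: "t \<in> T \<Longrightarrow> g \<in> carrier W \<Longrightarrow> g \<otimes> t \<otimes> inv g \<in> T"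
proof -
  assume "t \<in> T" "g \<in> carrier W"
  then obtain w s where "w \<in> carrier W" "s \<in> S" "t = w \<otimes> s \<otimes> inv w" by (auto simp: refl_iff)
  with \<open>g \<in> carrier W\<close> show ?thesis unfolding refl_iff
    by (intro bexI[of _ "g \<otimes> w"] bexI[of _ s]) (auto simp: m_assoc inv_mult_group)
qed

lemma refl_conj': "t \<in> T \<Longrightarrow> g \<in> carrier W \<Longrightarrow> inv g \<otimes> t \<otimes> g \<in> T"
  using refl_conj[of t "inv g"] by simp

text \<open>Whether \<open>t\<close> occurs an odd number of times among the reflections
  \<open>s\<^sub>1 \<dots> s\<^sub>i \<dots> s\<^sub>1\<close> of the word \<open>s\<^sub>1 \<dots> s\<^sub>k\<close>.\<close>
primrec refl_parity :: "'a list \<Rightarrow> 'a \<Rightarrow> bool" where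
  "refl_parity [] t = False"
| "refl_parity (s # ws) t = ((t = s) \<noteq> refl_parity ws (s \<otimes> t \<otimes> s))"

text \<open>Inside \<open>xs @ ys\<close>, the reflections read off from \<open>ys\<close> are
  conjugated by \<open>ev xs\<close>.\<close>

lemma parity_append:
  "xs \<in> lists S \<Longrightarrow> t \<in> carrier W \<Longrightarrow>
    refl_parity (xs @ ys) t = (refl_parity xs t \<noteq> refl_parity ys (inv (ev xs) \<otimes> t \<otimes> ev xs))"
  by (induction xs arbitrary: t) (auto simp: inv_mult_group m_assoc)

lemma conj_eq_iff: "g \<in> carrier W \<Longrightarrow> t \<in> carrier W \<Longrightarrow> r \<in> carrier W \<Longrightarrow>
   inv g \<otimes> t \<otimes> g = r \<longleftrightarrow> t = g \<otimes> r \<otimes> inv g"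
  by (auto simp: m_assoc)

lemma parity_split:
  "refl_parity ws t \<Longrightarrow> ws \<in> lists S \<Longrightarrow> t \<in> carrier W \<Longrightarrow>
    \<exists>xs s ys. ws = xs @ s # ys \<and> t = ev xs \<otimes> s \<otimes> inv (ev xs)"
proof (induction ws arbitrary: t)
  case (Cons a ws)
  show ?case
  proof (cases "t = a")
    case True
    then show ?thesis using Cons.prems by (intro exI[of _ "[]"] exI[of _ a] exI[of _ ws]) auto
  next
    case False
    then have "refl_parity ws (a \<otimes> t \<otimes> a)" using Cons.prems by simp
    from Cons.IH[OF this] Cons.prems obtain xs s ys where
      *: "ws = xs @ s # ys" "a \<otimes> t \<otimes> a = ev xs \<otimes> s \<otimes> inv (ev xs)" by auto
    have "t = a \<otimes> (a \<otimes> t \<otimes> a) \<otimes> a" using Cons.prems by (auto simp: m_assoc S_square)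
    also have "\<dots> = ev (a # xs) \<otimes> s \<otimes> inv (ev (a # xs))"
      unfolding *(2) using * Cons.prems by (auto simp: m_assoc inv_mult_group)
    finally show ?thesis using * by (metis append_Cons)
  qed
qed simp

text \<open>Strong exchange: \<open>t\<close> is a letter \<open>s\<close> conjugated by the prefix
  before it, so multiplying by \<open>t\<close> on the left deletes that letter. The letters stay in
  \<open>J\<close>, which matters for shortest words in a parabolic subgroup.\<close>

lemma parity_delete:
  assumes "refl_parity ws t" "ws \<in> lists J" "J \<subseteq> S" "t \<in> carrier W"
  shows "\<exists>vs\<in>lists J. length vs < length ws \<and> ev vs = t \<otimes> ev ws"
proof -
  have S: "ws \<in> lists S" using assms by (meson lists_mono subsetD)
  from parity_split[OF assms(1) S assms(4)] obtain xs s ys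
    where *: "ws = xs @ s # ys" "t = ev xs \<otimes> s \<otimes> inv (ev xs)" by blast
  have l: "xs \<in> lists S" "ys \<in> lists S" "s \<in> S" "xs @ ys \<in> lists J" using S assms * by auto
  have "ev ws = ev xs \<otimes> (s \<otimes> ev ys)" unfolding *(1) using l by (subst ev_append_S) auto
  then have "ev (xs @ ys) = t \<otimes> ev ws" using l * by (simp add: ev_append_S m_assoc)
  then show ?thesis using l * by (intro bexI[of _ "xs @ ys"]) auto
qed

section \<open>Alternating words and invariance of the parity under the relations\<close>

definition alt :: "'a \<Rightarrow> 'a \<Rightarrow> nat \<Rightarrow> 'a list" where
  "alt s t k = map (\<lambda>i. if even i then s else t) [0..<k]"

lemma alt_elem_alt: "alt_elem W s t k = ev (alt s t k)"
  by (simp add: alt_elem_def alt_def)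

lemma alt_0 [simp]: "alt s t 0 = []" by (simp add: alt_def)

lemma alt_Suc: "alt s t (Suc k) = s # alt t s k"
proof -
  have "[0..<Suc k] = 0 # map Suc [0..<k]"
    by (simp only: map_Suc_upt upt_conv_Cons zero_less_Suc)
  then show ?thesis by (simp add: alt_def del: upt_Suc)
qed

lemma alt_lists: "s \<in> J \<Longrightarrow> t \<in> J \<Longrightarrow> alt s t k \<in> lists J"
  by (auto simp: alt_def)

lemma relator_alt: "concat (replicate k [s, t]) = alt s t (2 * k)"
  by (induction k) (auto simp: alt_Suc)

lemma pow_shift: "s \<in> carrier W \<Longrightarrow> t \<in> carrier W \<Longrightarrow> s \<otimes> (t \<otimes> s) [^] (i::nat) \<otimes> t = (s \<otimes> t) [^] Suc i"
proof (induction i)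
  case (Suc i)
  have "s \<otimes> (t \<otimes> s) [^] Suc i \<otimes> t = (s \<otimes> (t \<otimes> s) [^] i \<otimes> t) \<otimes> (s \<otimes> t)"
    using Suc.prems by (simp add: m_assoc)
  then show ?case using Suc by simp
qed simp

lemma card_less_Suc_shift:
  "card {i. i < Suc k \<and> P i} = (if P 0 then 1 else 0) + card {i. i < k \<and> P (Suc i)}"
proof -
  have "{i. i < Suc k \<and> P i} = (if P 0 then {0} else {}) \<union> Suc ` {i. i < k \<and> P (Suc i)}"
    by (auto simp: image_iff less_Suc_eq_0_disj)
  then show ?thesis by (auto simp: card_insert_if card_image)
qed

text \<open>The reflection at position \<open>i\<close> of the alternating word is
  \<open>(st)^i s\<close>. Removing the first letter swaps \<open>s\<close> and \<open>t\<close> and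
  shifts the index, by \<open>pow_shift\<close>.\<close>

lemma parity_alt:
  "s \<in> S \<Longrightarrow> t \<in> S \<Longrightarrow> r \<in> carrier W \<Longrightarrow>
    refl_parity (alt s t k) r \<longleftrightarrow> odd (card {i. i < k \<and> r = (s \<otimes> t) [^] i \<otimes> s})"
proof (induction k arbitrary: s t r)
  case (Suc k)
  have eq: "s \<otimes> r \<otimes> s = (t \<otimes> s) [^] i \<otimes> t \<longleftrightarrow> r = (s \<otimes> t) [^] Suc i \<otimes> s" for i :: nat
  proof -
    have "s \<otimes> r \<otimes> s = (t \<otimes> s) [^] i \<otimes> t \<longleftrightarrow> r = s \<otimes> ((t \<otimes> s) [^] i \<otimes> t) \<otimes> s"
      using conj_eq_iff[of s r "(t \<otimes> s) [^] i \<otimes> t"] Suc.prems by simp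
    also have "s \<otimes> ((t \<otimes> s) [^] i \<otimes> t) \<otimes> s = (s \<otimes> t) [^] Suc i \<otimes> s"
      using pow_shift[of s t i] Suc.prems by (simp add: m_assoc)
    finally show ?thesis .
  qed
  show ?case unfolding card_less_Suc_shift alt_Suc
    using Suc eq by auto
qed simp

text \<open>The reflections \<open>(st)^i s\<close> have period \<open>m(s,t)\<close> in
  \<open>i\<close>, so each occurs equally often in the two halves of the relator.\<close>

lemma parity_relator:
  assumes "s \<in> S" "t \<in> S" "r \<in> carrier W"
  shows "\<not> refl_parity (alt s t (2 * cox_m W s t)) r"
proof -
  define m where "m = cox_m W s t"
  have per: "(s \<otimes> t) [^] (m + i) = (s \<otimes> t) [^] i" for i
    using assms by (simp add: m_def cox_m_def pow_ord_eq_1 flip: nat_pow_mult)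
  let ?A = "{i. i < m \<and> r = (s \<otimes> t) [^] i \<otimes> s}"
  have "{i. i < 2 * m \<and> r = (s \<otimes> t) [^] i \<otimes> s} = ?A \<union> (\<lambda>i. m + i) ` ?A" (is "?B = _")
  proof (intro equalityI subsetI)
    fix i assume i: "i \<in> ?B"
    show "i \<in> ?A \<union> (\<lambda>i. m + i) ` ?A"
    proof (cases "i < m")
      case False
      then have "i = m + (i - m)" by simp
      moreover have "i - m \<in> ?A" using i False per[of "i - m"] by auto
      ultimately show ?thesis by blast
    qed (use i in auto)
  qed (auto simp: per)
  moreover have "card (?A \<union> (\<lambda>i. m + i) ` ?A) = card ?A + card ((\<lambda>i. m + i) ` ?A)"
    by (rule card_Un_disjoint) auto
  moreover have "card ((\<lambda>i. m + i) ` ?A) = card ?A" by (rule card_image) auto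
  ultimately show ?thesis using parity_alt[OF assms] by (simp add: m_def)
qed

lemma relators:
  assumes "r \<in> cox_relators W S"
  shows "r \<in> lists S" "ev r = \<one>" "t \<in> carrier W \<Longrightarrow> \<not> refl_parity r t"
proof -
  from assms obtain a b where *: "a \<in> S" "b \<in> S" "r = alt a b (2 * cox_m W a b)"
    unfolding cox_relators_def relator_alt by blast
  then show "r \<in> lists S" by (simp only: alt_lists)
  show "ev r = \<one>" using * word_eval_power[of a b] by (simp add: cox_m_def flip: relator_alt)
  show "t \<in> carrier W \<Longrightarrow> \<not> refl_parity r t" using parity_relator * by blast
qed

text \<open>A relator contributes even counts and evaluates to the identity, so deleting it leaves
  the conjugations on the rest of the word unchanged. The disjunction in the premise lets a step be
  read in either direction.\<close>

lemma rel_step_parity: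
  assumes "rel_step (cox_relators W S) u v" "u \<in> lists S \<or> v \<in> lists S" "t \<in> carrier W"
  shows "u \<in> lists S" "v \<in> lists S" "refl_parity u t = refl_parity v t"
proof -
  from assms(1) obtain r x y where *: "r \<in> cox_relators W S" "u = x @ r @ y" "v = x @ y"
    by (auto elim: rel_step.cases)
  show uv: "u \<in> lists S" "v \<in> lists S" using assms(2) * relators(1)[OF *(1)] by auto
  then have xy: "x \<in> lists S" "r \<in> lists S" "y \<in> lists S" using * by auto
  have "refl_parity (r @ y) g = refl_parity y g" if "g \<in> carrier W" for g
    using parity_append[of r g y] relators[OF *(1)] xy that by auto
  then show "refl_parity u t = refl_parity v t" using parity_append[of x] xy assms(3) *(2,3)
    by auto
qed

lemma pres_equiv_parity:
  assumes "pres_equiv (cox_relators W S) u v" "u \<in> lists S" "t \<in> carrier W"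
  shows "v \<in> lists S \<and> refl_parity u t = refl_parity v t"
  using assms(1) unfolding pres_equiv_def
proof (induction rule: rtranclp_induct)
  case (step v w)
  then show ?case using rel_step_parity assms(3)
    by (metis (no_types, lifting) conversep_iff sup2E)
qed (use assms in auto)

text \<open>The concatenation \<open>ws @ vs\<close> represents the identity and so has the parity
  of the empty word; the contributions of its two factors must agree.\<close>

lemma parity_inverse:
  assumes "ws \<in> lists S" "vs \<in> lists S" "ev ws \<otimes> ev vs = \<one>" "t \<in> carrier W"
  shows "refl_parity vs (inv (ev ws) \<otimes> t \<otimes> ev ws) = refl_parity ws t"
proof -
  have "pres_equiv (cox_relators W S) (ws @ vs) []"
    using assms presentation[of "ws @ vs"] ev_append_S by auto
  then have "\<not> refl_parity (ws @ vs) t" using pres_equiv_parity assms by fastforce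
  then show ?thesis using parity_append assms by auto
qed

text \<open>Both parities equal that of the same inverse word \<open>rev ws\<close> at a conjugate
  of \<open>t\<close>.\<close>

lemma parity_cong:
  assumes "ws \<in> lists S" "vs \<in> lists S" "ev ws = ev vs" "t \<in> carrier W"
  shows "refl_parity ws t = refl_parity vs t"
proof -
  define g where "g = inv (ev ws) \<otimes> t \<otimes> ev ws"
  have r: "rev ws \<in> lists S" using assms by auto
  have "refl_parity (rev ws) g = refl_parity ws t" "refl_parity (rev ws) g = refl_parity vs t"
    unfolding g_def
    using assms r parity_inverse[of ws "rev ws" t] parity_inverse[of vs "rev ws" t] by (auto simp: ev_rev)
  then show ?thesis by simp
qed

text \<open>Write \<open>t = w s w^-1\<close> as a palindrome: the two outer parts contribute equal
  parities and cancel, and the middle letter contributes \<open>t\<close> once.\<close>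

lemma parity_refl:
  assumes "t \<in> T" "ws \<in> lists S" "ev ws = t"
  shows "refl_parity ws t"
proof -
  from assms(1) obtain w s where *: "w \<in> carrier W" "s \<in> S" "t = w \<otimes> s \<otimes> inv w"
    by (auto simp: refl_iff)
  from words_onto[OF *(1)] obtain vs where vs: "vs \<in> lists S" "ev vs = w" by blast
  have r: "rev vs \<in> lists S" using vs by auto
  have cj: "inv w \<otimes> t \<otimes> w = s" using * by (simp add: m_assoc)
  have t: "t \<in> carrier W" using assms by simp
  have "refl_parity (vs @ [s] @ rev vs) t = (refl_parity vs t \<noteq> (True \<noteq> refl_parity (rev vs) s))"
    using parity_append[of vs t "[s] @ rev vs"] vs cj t * S_square by (simp add: m_assoc)
  moreover have "refl_parity (rev vs) s = refl_parity vs t"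
    using parity_inverse[of vs "rev vs" t] vs cj t r * by (simp only: ev_rev r_inv)
  moreover have "ev (vs @ [s] @ rev vs) = t"
    using vs * r by (simp add: ev_append_S ev_rev m_assoc)
  moreover have "vs @ [s] @ rev vs \<in> lists S" using r vs * by auto
  ultimately show ?thesis using parity_cong[of ws "vs @ [s] @ rev vs" t] assms(2,3) t by metis
qed

lemma len_less_if_parity:
  assumes "refl_parity ws t" "ws \<in> lists S" "t \<in> carrier W"
  shows "len (t \<otimes> ev ws) < len (ev ws)"
proof -
  from len_word[of "ev ws"] assms obtain vs where
    vs: "vs \<in> lists S" "length vs = len (ev ws)" "ev vs = ev ws" by auto
  then have "refl_parity vs t" using parity_cong assms by metis
  from parity_delete[OF this vs(1) _ assms(3)] vs len_le show ?thesis
    by (metis le_less_trans order_refl)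
qed

lemma parity_mult:
  assumes "t \<in> T" "ws \<in> lists S" "vs \<in> lists S" "ev vs = t \<otimes> ev ws"
  shows "refl_parity vs t \<noteq> refl_parity ws t"
proof -
  have t: "t \<in> carrier W" "inv t = t" using assms refl_square by (auto intro: inv_equality)
  obtain us where us: "us \<in> lists S" "ev us = t" using words_onto t by blast
  have "refl_parity vs t = refl_parity (us @ ws) t" using parity_cong[of vs "us @ ws" t] assms us t
    by (auto simp: ev_append_S)
  also have "\<dots> = (\<not> refl_parity ws t)" using parity_append[of us t ws] parity_refl[of t us] us assms t
    by (simp add: refl_square)
  finally show ?thesis by simp
qed

text \<open>Passing from \<open>w\<close> to \<open>t w\<close> flips the parity at
  \<open>t\<close>, and an element with odd parity at \<open>t\<close> is shortened by
  \<open>t\<close>. So the parity decides which of the two is the longer.\<close>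

lemma len_mult_refl:
  assumes "t \<in> T" "w \<in> carrier W"
  shows "len (t \<otimes> w) \<noteq> len w"
    and "ws \<in> lists S \<Longrightarrow> ev ws = w \<Longrightarrow> len (t \<otimes> w) < len w \<longleftrightarrow> refl_parity ws t"
proof -
  have t: "t \<in> carrier W" using assms by simp
  obtain us vs where us: "us \<in> lists S" "ev us = w" and vs: "vs \<in> lists S" "ev vs = t \<otimes> w"
    using words_onto assms t by (metis m_closed)
  have ww: "t \<otimes> (t \<otimes> w) = w"
    using assms t refl_square by (metis l_one m_assoc)
  have "refl_parity vs t \<noteq> refl_parity us t" using parity_mult assms us vs by blast
  then have *: "refl_parity us t \<and> len (t \<otimes> w) < len w \<or> \<not> refl_parity us t \<and> len w < len (t \<otimes> w)"
    using len_less_if_parity[of us t] len_less_if_parity[of vs t] us vs t ww by auto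
  then show "len (t \<otimes> w) \<noteq> len w" by auto
  show "len (t \<otimes> w) < len w \<longleftrightarrow> refl_parity ws t" if "ws \<in> lists S" "ev ws = w"
    using * parity_cong[of us ws t] us that t by auto
qed

lemma N_parity: "ws \<in> lists S \<Longrightarrow> t \<in> N (ev ws) \<longleftrightarrow> t \<in> T \<and> refl_parity ws t"
  unfolding inv_set_def using len_mult_refl(2)[of t "ev ws" ws] by (simp add: lists_carrier conj_commute cong: conj_cong)

lemma N_refl: "N w \<subseteq> T" by (auto simp: inv_set_def)

text \<open>The cocycle rule: \<open>parity_append\<close> freed from the choice of words. The later
  computations of inversion sets rest on it.\<close>

lemma N_mult:
  assumes "u \<in> carrier W" "v \<in> carrier W" "t \<in> T"
  shows "t \<in> N (u \<otimes> v) \<longleftrightarrow> ((t \<in> N u) \<noteq> (inv u \<otimes> t \<otimes> u \<in> N v))"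
proof -
  obtain us vs where us: "us \<in> lists S" "ev us = u" and vs: "vs \<in> lists S" "ev vs = v"
    using words_onto assms by metis
  have "t \<in> N (ev (us @ vs)) \<longleftrightarrow> refl_parity (us @ vs) t"
    using us vs assms N_parity by (metis append_in_lists_conv)
  also have "\<dots> \<longleftrightarrow> ((t \<in> N u) \<noteq> (inv u \<otimes> t \<otimes> u \<in> N v))"
    using us vs assms parity_append[of us t vs] N_parity[of us t] N_parity[of vs] refl_conj'[of t u]
    by auto
  finally show ?thesis using us vs by (simp add: ev_append_S)
qed

lemma N_one [simp]: "N \<one> = {}"
  using N_parity[of "[]"] by auto

lemma N_S: "s \<in> S \<Longrightarrow> N s = {s}"
  using N_parity[of "[s]"] S_refl by auto

end

section \<open>Parabolic subgroups\<close>

lemma finite_has_maximizer: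
  fixes f :: "'x \<Rightarrow> nat"
  assumes "finite A" "A \<noteq> {}"
  shows "\<exists>w\<in>A. \<forall>v\<in>A. f v \<le> f w"
proof -
  have "Max (f ` A) \<in> f ` A" using assms by simp
  then show ?thesis using assms by (metis (mono_tags, lifting) Max_ge finite_imageI imageE imageI)
qed

context coxeter begin

lemma parity_T:
  assumes "refl_parity ws t" "ws \<in> lists S" "t \<in> carrier W"
  shows "t \<in> T"
proof -
  from parity_split[OF assms] obtain xs s ys where
    *: "ws = xs @ s # ys" "t = ev xs \<otimes> s \<otimes> inv (ev xs)" by blast
  then have "ev xs \<in> carrier W" "s \<in> S" using assms by auto
  then show ?thesis using * refl_iff by blast
qed

definition parabolic :: "'a set \<Rightarrow> 'a set" where "parabolic J = ev ` lists J"

lemma parabolic_closed: "J \<subseteq> S \<Longrightarrow> x \<in> parabolic J \<Longrightarrow> x \<in> carrier W"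
  unfolding parabolic_def by (metis word_eval_closed imageE lists_carrier)

lemma parabolic_S: "parabolic S = carrier W"
  using words_onto parabolic_closed[of S] by (auto simp: parabolic_def)

lemma parabolic_mono: "J \<subseteq> K \<Longrightarrow> parabolic J \<subseteq> parabolic K"
  unfolding parabolic_def by (intro image_mono lists_mono) auto

lemma parabolic_one: "\<one> \<in> parabolic J"
  unfolding parabolic_def using word_eval_Nil by (metis image_eqI lists.Nil)

lemma parabolic_gen: "J \<subseteq> S \<Longrightarrow> s \<in> J \<Longrightarrow> s \<in> parabolic J"
  unfolding parabolic_def by (rule image_eqI[of _ _ "[s]"]) (auto simp: subset_iff)

lemma parabolic_mult: "J \<subseteq> S \<Longrightarrow> x \<in> parabolic J \<Longrightarrow> y \<in> parabolic J \<Longrightarrow> x \<otimes> y \<in> parabolic J"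
proof -
  assume J: "J \<subseteq> S" and "x \<in> parabolic J" "y \<in> parabolic J"
  then obtain xs ys where w: "xs \<in> lists J" "ys \<in> lists J" "x = ev xs" "y = ev ys"
    by (auto simp: parabolic_def)
  then have "xs @ ys \<in> lists J" by simp
  moreover have "x \<otimes> y = ev (xs @ ys)"
    using w word_eval_append[OF lists_carrier[OF J w(1)] lists_carrier[OF J w(2)]] by simp
  ultimately show "x \<otimes> y \<in> parabolic J" by (simp add: parabolic_def)
qed

lemma parabolic_inv: "J \<subseteq> S \<Longrightarrow> x \<in> parabolic J \<Longrightarrow> inv x \<in> parabolic J"
proof -
  assume J: "J \<subseteq> S" "x \<in> parabolic J"
  then obtain ws where ws: "ws \<in> lists J" "x = ev ws" by (auto simp: parabolic_def)
  then have "ws \<in> lists S" using J by (meson lists_mono subsetD)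
  with ws have "inv x = ev (rev ws)" "rev ws \<in> lists J" by (auto simp: ev_rev)
  then show ?thesis by (auto simp: parabolic_def)
qed

lemma N_parabolic:
  assumes "J \<subseteq> S" "x \<in> parabolic J"
  shows "N x \<subseteq> parabolic J"
proof
  fix t assume t: "t \<in> N x"
  from assms obtain ws where ws: "ws \<in> lists J" "x = ev ws" by (auto simp: parabolic_def)
  then have S: "ws \<in> lists S" using assms by (meson lists_mono subsetD)
  then have "refl_parity ws t" "t \<in> carrier W" using t ws N_parity by auto
  from parity_split[OF this(1) S this(2)] obtain xs s ys where
    *: "ws = xs @ s # ys" "t = ev xs \<otimes> s \<otimes> inv (ev xs)" by blast
  then have "ev xs \<in> parabolic J" "s \<in> J" using ws by (auto simp: parabolic_def)
  then show "t \<in> parabolic J" unfolding * using assms(1) parabolic_gen[of J s] by (intro parabolic_mult parabolic_inv)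
qed

lemma S_parabolic:
  assumes "J \<subseteq> S" "s \<in> J" "x \<in> parabolic J"
  shows "s \<otimes> x \<in> parabolic J"
  using assms parabolic_gen parabolic_mult by blast

text \<open>A shortest \<open>J\<close>-word of \<open>x\<close> starts with an inversion of \<open>x\<close>: otherwise its first letter
  could be cancelled against a later one.\<close>
lemma parabolic_descent:
  assumes J: "J \<subseteq> S" and x: "x \<in> parabolic J" "x \<noteq> \<one>"
  shows "\<exists>s\<in>J. s \<in> N x"
proof -
  have "\<exists>n ws. ws \<in> lists J \<and> ev ws = x \<and> length ws = n" using x by (auto simp: parabolic_def)
  then obtain n where n: "\<exists>ws. ws \<in> lists J \<and> ev ws = x \<and> length ws = n"
    and min: "\<And>k. k < n \<Longrightarrow> \<not> (\<exists>ws. ws \<in> lists J \<and> ev ws = x \<and> length ws = k)"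
    using exists_least_iff[of "\<lambda>n. \<exists>ws. ws \<in> lists J \<and> ev ws = x \<and> length ws = n"] by blast
  then obtain ws where ws: "ws \<in> lists J" "ev ws = x" "length ws = n" by blast
  with x obtain s ys where ys: "ws = s # ys" by (cases ws) auto
  have s: "s \<in> J" "s \<in> S" "ys \<in> lists J" using ws ys J by auto
  have S: "ws \<in> lists S" using ws J by (meson lists_mono subsetD)
  have "\<not> refl_parity ys s"
  proof
    assume "refl_parity ys s"
    from parity_delete[OF this s(3) J] s obtain vs where
      "vs \<in> lists J" "length vs < length ys" "ev vs = s \<otimes> ev ys" by auto
    then show False using min[of "length vs"] ws ys by auto
  qed
  then have "refl_parity ws s" using ys s by (simp add: S_square)
  then have "s \<in> N x" using N_parity[OF S] ws s S_refl by blast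
  then show ?thesis using s by blast
qed

lemma N_len: "t \<in> N x \<Longrightarrow> len (t \<otimes> x) < len x"
  by (simp add: inv_set_def)

lemma N_empty: "w \<in> carrier W \<Longrightarrow> N w = {} \<Longrightarrow> w = \<one>"
  using parabolic_descent[of S w] parabolic_S by auto

text \<open>By the cocycle rule \<open>N (u^-1 v)\<close> equals \<open>N (u^-1 u)\<close>, which is
  empty, and only the identity has no inversions. This makes the weak order antisymmetric.\<close>

lemma N_inj:
  assumes "u \<in> carrier W" "v \<in> carrier W" "N u = N v"
  shows "u = v"
proof -
  have "t \<notin> N (inv u \<otimes> v)" if t: "t \<in> T" for t
    using N_mult[of "inv u" v t] N_mult[of "inv u" u t] assms t by simp
  then have "N (inv u \<otimes> v) = {}" using N_refl by blast
  then have "inv u \<otimes> v = \<one>" using N_empty assms by simp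
  then show ?thesis using assms by (metis inv_cancel(1) r_one)
qed

lemma parabolic_S_mem: "J \<subseteq> S \<Longrightarrow> s \<in> S \<Longrightarrow> s \<in> parabolic J \<Longrightarrow> s \<in> J"
  using parabolic_descent[of J s] N_S[of s] one_notin_S by auto

text \<open>Strip a simple inversion \<open>s \<in> J\<close> of \<open>x\<close>: being an
  inversion, it also lies in \<open>parabolic K\<close>, so \<open>s \<in> K\<close>, and the
  shorter element \<open>s x\<close> lies in both subgroups again.\<close>

lemma parabolic_Int:
  assumes "J \<subseteq> S" "K \<subseteq> S"
  shows "x \<in> parabolic J \<Longrightarrow> x \<in> parabolic K \<Longrightarrow> x \<in> parabolic (J \<inter> K)"
proof (induction "len x" arbitrary: x rule: less_induct)
  case less
  show ?case
  proof (cases "x = \<one>")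
    case False
    then obtain s where s: "s \<in> J" "s \<in> N x" using parabolic_descent less assms by blast
    then have "s \<in> parabolic K" using N_parabolic assms less by blast
    then have K: "s \<in> K" using parabolic_S_mem assms s by blast
    have "s \<otimes> x \<in> parabolic (J \<inter> K)" using less s K S_parabolic assms N_len by blast
    then have "s \<otimes> (s \<otimes> x) \<in> parabolic (J \<inter> K)" using s K assms S_parabolic[of "J \<inter> K" s "s \<otimes> x"] by blast
    then show ?thesis using s less.prems assms parabolic_closed by (metis S_cancel subsetD)
  qed (simp add: parabolic_one)
qed

lemma parabolic_singleton: "s \<in> S \<Longrightarrow> x \<in> parabolic {s} \<Longrightarrow> x = \<one> \<or> x = s"
proof -
  assume s: "s \<in> S" and "x \<in> parabolic {s}"
  then obtain ws where ws: "ws \<in> lists {s}" "x = ev ws" by (auto simp: parabolic_def)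
  from ws(1) have "ev ws = \<one> \<or> ev ws = s"
    by (induction ws) (use s in \<open>auto simp: S_square\<close>)
  with ws show ?thesis by simp
qed

text \<open>Factor \<open>w = x v\<close> with \<open>x\<close> in the parabolic subgroup and \<open>v\<close> of minimal length.\<close>
lemma parabolic_proj:
  assumes J: "J \<subseteq> S" and w: "w \<in> carrier W"
  obtains x where "x \<in> parabolic J" "N x = N w \<inter> parabolic J"
proof -
  obtain x where x: "x \<in> parabolic J" and min: "\<And>y. y \<in> parabolic J \<Longrightarrow> len (inv x \<otimes> w) \<le> len (inv y \<otimes> w)"
    using ex_has_least_nat[of "\<lambda>y. y \<in> parabolic J" "\<one>" "\<lambda>y. len (inv y \<otimes> w)"] parabolic_one by blast
  define v where "v = inv x \<otimes> w"
  have xc: "x \<in> carrier W" using parabolic_closed J x by blast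
  have v: "v \<in> carrier W" "w = x \<otimes> v" using xc w by (simp_all add: v_def)
  have Nv: "t \<notin> N v" if "t \<in> parabolic J" for t
  proof
    assume t: "t \<in> N v"
    have tc: "t \<in> carrier W" using that parabolic_closed J by blast
    then have "t \<otimes> v = inv (x \<otimes> inv t) \<otimes> w" using xc w by (simp add: v_def inv_mult_group m_assoc)
    then have "len v \<le> len (t \<otimes> v)" using min[of "x \<otimes> inv t"] that x J parabolic_mult parabolic_inv v_def by simp
    then show False using N_len[OF t] by simp
  qed
  \<comment> \<open>Inside the subgroup the second term of the cocycle rule for \<open>x v\<close>
    vanishes: conjugation by \<open>x\<close> stays in the subgroup, and \<open>N v\<close> avoids
    it.\<close>
  have "t \<in> N x \<longleftrightarrow> t \<in> N w \<inter> parabolic J" for t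
  proof (cases "t \<in> T \<and> t \<in> parabolic J")
    case True
    then have "inv x \<otimes> t \<otimes> x \<in> parabolic J" using x J by (intro parabolic_mult parabolic_inv) auto
    then show ?thesis using N_mult[of x v t] v xc Nv True by auto
  next
    case False
    then show ?thesis using N_parabolic J x N_refl by blast
  qed
  then show ?thesis using that x by blast
qed

lemma cox_m_sym:
  assumes "s \<in> S" "t \<in> S"
  shows "cox_m W s t = cox_m W t s"
proof -
  have "t \<otimes> s = inv (s \<otimes> t)" using assms by (simp add: inv_mult_group)
  then show ?thesis using assms by (simp add: cox_m_def ord_inv)
qed

lemma ev_alt_quot: "s \<in> S \<Longrightarrow> t \<in> S \<Longrightarrow>
   ev (alt s t k) \<otimes> inv (ev (alt t s k)) = (s \<otimes> t) [^] k"
proof (induction k arbitrary: s t)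
  case (Suc k)
  have c: "ev (alt s t k) \<in> carrier W" "ev (alt t s k) \<in> carrier W"
    by (rule ev_closed_S, rule alt_lists; use Suc in simp)+
  have "ev (alt s t (Suc k)) \<otimes> inv (ev (alt t s (Suc k))) =
      s \<otimes> (ev (alt t s k) \<otimes> inv (ev (alt s t k))) \<otimes> t"
    using Suc.prems c by (simp add: alt_Suc inv_mult_group m_assoc)
  also have "\<dots> = (s \<otimes> t) [^] Suc k" using Suc.IH[of t s] pow_shift[of s t k] Suc.prems by simp
  finally show ?case .
qed simp

lemma alt_closed: "s \<in> S \<Longrightarrow> t \<in> S \<Longrightarrow> ev (alt s t k) \<in> carrier W"
  by (rule ev_closed_S, rule alt_lists)

lemma alt_m:
  assumes "s \<in> S" "t \<in> S"
  shows "ev (alt s t (cox_m W s t)) = ev (alt t s (cox_m W s t))"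
proof -
  have "ev (alt s t (cox_m W s t)) \<otimes> inv (ev (alt t s (cox_m W s t))) = \<one>"
    using ev_alt_quot[OF assms] assms by (simp add: cox_m_def pow_ord_eq_1)
  then show ?thesis using alt_closed assms
    by (metis inv_closed inv_equality inv_inv)
qed

end

section \<open>Finite Coxeter groups and their dihedral parabolic subgroups\<close>

locale finite_coxeter = coxeter +
  assumes fin: "finite (carrier W)"
begin

lemma cox_m_self: "s \<in> S \<Longrightarrow> cox_m W s s = 1"
  by (simp add: cox_m_def S_square)

lemma cox_m_ge:
  assumes "s \<in> S" "t \<in> S" "s \<noteq> t"
  shows "2 \<le> cox_m W s t"
proof -
  have "s \<otimes> t \<noteq> \<one>" using assms by (metis S_closed S_inv inv_equality inv_inv)
  then have "cox_m W s t \<noteq> 1" unfolding cox_m_def using assms ord_eq_1 by auto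
  moreover have "cox_m W s t \<ge> 1" unfolding cox_m_def using assms ord_ge_1[OF fin] by auto
  ultimately show ?thesis by linarith
qed

lemma rotation_inj:
  assumes "s \<in> S" "t \<in> S" "i < cox_m W s t" "j < cox_m W s t"
    "(s \<otimes> t) [^] i \<otimes> s = (s \<otimes> t) [^] j \<otimes> s"
  shows "i = j"
proof -
  have "(s \<otimes> t) [^] i = (s \<otimes> t) [^] j" using assms by simp
  moreover have "i \<in> {0..ord (s \<otimes> t) - 1}" "j \<in> {0..ord (s \<otimes> t) - 1}"
    using assms unfolding cox_m_def by auto
  ultimately show ?thesis using ord_inj[of "s \<otimes> t"] assms by (auto dest: inj_onD)
qed

text \<open>For \<open>k \<le> m(s,t)\<close> the reflections \<open>(st)^i s\<close> with
  \<open>i < k\<close> are distinct, so each is counted once and nothing cancels.\<close>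

lemma N_alt:
  assumes st: "s \<in> S" "t \<in> S" and k: "k \<le> cox_m W s t"
  shows "N (ev (alt s t k)) = (\<lambda>i. (s \<otimes> t) [^] i \<otimes> s) ` {..<k}" (is "_ = ?f ` _")
    and "card (N (ev (alt s t k))) = k"
proof -
  have l: "alt s t k \<in> lists S" using st by (simp only: alt_lists)
  have inj: "inj_on ?f {..<k}" using rotation_inj st k by (auto simp: inj_on_def)
  have "r \<in> N (ev (alt s t k)) \<longleftrightarrow> r \<in> ?f ` {..<k}" for r
  proof (cases "r \<in> carrier W")
    case True
    have "card {i. i < k \<and> r = ?f i} = (if r \<in> ?f ` {..<k} then 1 else 0)"
    proof (cases "r \<in> ?f ` {..<k}")
      case True
      then obtain i where "i < k" "r = ?f i" by auto
      then have "{i. i < k \<and> r = ?f i} = {i}" using inj by (auto simp: inj_on_def)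
      then show ?thesis using True by simp
    next
      case False
      then have "{i. i < k \<and> r = ?f i} = {}" by auto
      then show ?thesis using False by (metis card.empty)
    qed
    then have "refl_parity (alt s t k) r \<longleftrightarrow> r \<in> ?f ` {..<k}" using parity_alt[OF st True] by simp
    then show ?thesis using N_parity[OF l] parity_T[OF _ l True] by blast
  next
    case False
    moreover have "?f i \<in> carrier W" for i using st by simp
    ultimately show ?thesis using N_refl refl_closed by blast
  qed
  then show *: "N (ev (alt s t k)) = ?f ` {..<k}" by blast
  show "card (N (ev (alt s t k))) = k" unfolding * using inj by (simp add: card_image)
qed

lemma alt_N1:
  assumes "s \<in> S" "t \<in> S" "0 < k" "k \<le> cox_m W s t"
  shows "s \<in> N (ev (alt s t k))"
  using N_alt(1)[of s t k] assms by (auto intro!: image_eqI[of _ _ 0])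

text \<open>Putting \<open>t\<close> in front gives an alternating word of at most
  \<open>m(s,t)\<close> letters, which has \<open>t\<close> as an inversion; the cocycle rule then
  excludes \<open>t\<close> for the shorter word.\<close>

lemma alt_N2:
  assumes "s \<in> S" "t \<in> S" "k < cox_m W s t"
  shows "t \<notin> N (ev (alt s t k))"
proof -
  have "t \<in> N (ev (alt t s (Suc k)))" using alt_N1 assms cox_m_sym by auto
  then show ?thesis using N_mult[of t "ev (alt s t k)" t] assms alt_closed N_S S_refl
    by (auto simp: alt_Suc S_square)
qed

lemma alt_N2m:
  assumes "s \<in> S" "t \<in> S" "s \<noteq> t"
  shows "t \<in> N (ev (alt s t (cox_m W s t)))"
  using alt_N1[of t s "cox_m W s t"] alt_m[of s t] cox_m_ge[of s t] cox_m_sym[of s t] assms by simp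

text \<open>Left multiplication by a generator removes or adds a first letter. Only at length
  \<open>m(s,t)\<close> could it lead too far, and there \<open>alt_m\<close> rewrites the word so
  that a letter is removed.\<close>

lemma dihedral_elements:
  assumes st: "s \<in> S" "t \<in> S" "s \<noteq> t" and x: "x \<in> parabolic {s, t}"
  obtains k where "k \<le> cox_m W s t" "x = ev (alt s t k) \<or> x = ev (alt t s k)"
proof -
  have step1: "\<exists>j\<le>cox_m W a b. a \<otimes> ev (alt a b k) = ev (alt a b j) \<or> a \<otimes> ev (alt a b k) = ev (alt b a j)"
    if "a \<in> S" "b \<in> S" "a \<noteq> b" "k \<le> cox_m W a b" for a b k
  proof (cases k)
    case 0
    then have "a \<otimes> ev (alt a b k) = ev (alt a b 1)" by (simp add: alt_Suc)
    then show ?thesis using cox_m_ge[of a b] that by (intro exI[of _ 1]) auto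
  next
    case (Suc j)
    then have "a \<otimes> ev (alt a b k) = ev (alt b a j)" using that alt_closed by (simp add: alt_Suc)
    then show ?thesis using that Suc by (intro exI[of _ j]) auto
  qed
  have step2: "\<exists>j\<le>cox_m W a b. a \<otimes> ev (alt b a k) = ev (alt a b j) \<or> a \<otimes> ev (alt b a k) = ev (alt b a j)"
    if "a \<in> S" "b \<in> S" "a \<noteq> b" "k \<le> cox_m W a b" for a b k
  proof (cases "k = cox_m W a b")
    case True
    then show ?thesis using step1[of a b k] alt_m[of a b] that by simp
  next
    case False
    then show ?thesis using that by (intro exI[of _ "Suc k"]) (auto simp: alt_Suc)
  qed
  from x obtain ws where ws: "ws \<in> lists {s, t}" "x = ev ws" by (auto simp: parabolic_def)
  from ws(1) have "\<exists>k\<le>cox_m W s t. ev ws = ev (alt s t k) \<or> ev ws = ev (alt t s k)"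
  proof induction
    case Nil
    then show ?case by (intro exI[of _ 0]) simp
  next
    case (Cons a l)
    then obtain k where k: "k \<le> cox_m W s t" "ev l = ev (alt s t k) \<or> ev l = ev (alt t s k)" by blast
    have "a = s \<or> a = t" using Cons by simp
    then show ?case
    proof
      assume "a = s"
      then show ?thesis using step1[of s t k] step2[of s t k] k st by auto
    next
      assume "a = t"
      then show ?thesis using step1[of t s k] step2[of t s k] k st cox_m_sym[of s t] by auto
    qed
  qed
  then show ?thesis using that ws by blast
qed

text \<open>An element of maximal length in \<open>parabolic J\<close> is not lengthened by a
  reflection of the subgroup, and a reflection always changes the length.\<close>

lemma parabolic_top:
  assumes J: "J \<subseteq> S"
  obtains w where "w \<in> parabolic J" "N w = T \<inter> parabolic J"
proof -
  have fJ: "finite (parabolic J)" using parabolic_closed[OF J] fin by (meson finite_subset subsetI)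
  obtain w where w: "w \<in> parabolic J" and max: "\<And>v. v \<in> parabolic J \<Longrightarrow> len v \<le> len w"
    using finite_has_maximizer[OF fJ, of len] parabolic_one[of J] by blast
  have "t \<in> N w" if t: "t \<in> T" "t \<in> parabolic J" for t
    using max[of "t \<otimes> w"] len_mult_refl(1)[of t w] parabolic_mult[OF J t(2) w] parabolic_closed[OF J w] t
    by (simp add: inv_set_def)
  then have "N w = T \<inter> parabolic J" using N_parabolic[OF J w] N_refl by blast
  then show ?thesis using that w by blast
qed

text \<open>Among alternating words only those of full length have both \<open>s\<close> and
  \<open>t\<close> as inversions, so the top element of the subgroup is one of them.\<close>

lemma dihedral_top:
  assumes st: "s \<in> S" "t \<in> S" "s \<noteq> t"
  shows "N (ev (alt s t (cox_m W s t))) = T \<inter> parabolic {s, t}"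
proof -
  have J: "{s, t} \<subseteq> S" using st by simp
  obtain w where w: "w \<in> parabolic {s, t}" "N w = T \<inter> parabolic {s, t}" using parabolic_top J by blast
  then have m: "s \<in> N w" "t \<in> N w" using parabolic_gen[OF J] S_refl st by auto
  obtain k where k: "k \<le> cox_m W s t" "w = ev (alt s t k) \<or> w = ev (alt t s k)"
    using dihedral_elements st w by blast
  have "k = cox_m W s t"
    using k m alt_N2[of s t k] alt_N2[of t s k] cox_m_sym[of s t] st by (metis le_neq_implies_less)
  then show ?thesis using w k alt_m[OF st(1,2)] by metis
qed

text \<open>The projection of \<open>w\<close> to the dihedral subgroup still has \<open>s\<close>
  and \<open>t\<close> as inversions, so it is the top element there. In other words, that top
  element is the join of \<open>s\<close> and \<open>t\<close>.\<close>

lemma dihedral_subset: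
  assumes st: "s \<in> S" "t \<in> S" "s \<noteq> t" and w: "w \<in> carrier W" "s \<in> N w" "t \<in> N w"
  shows "T \<inter> parabolic {s, t} \<subseteq> N w"
proof -
  have J: "{s, t} \<subseteq> S" using st by simp
  obtain x where x: "x \<in> parabolic {s, t}" "N x = N w \<inter> parabolic {s, t}" using parabolic_proj J w by blast
  then have m: "s \<in> N x" "t \<in> N x" using parabolic_gen[OF J] w by auto
  obtain k where k: "k \<le> cox_m W s t" "x = ev (alt s t k) \<or> x = ev (alt t s k)"
    using dihedral_elements st x by blast
  have "k = cox_m W s t"
    using k m alt_N2[of s t k] alt_N2[of t s k] cox_m_sym[of s t] st by (metis le_neq_implies_less)
  then have "N x = T \<inter> parabolic {s, t}" using dihedral_top[OF st] k alt_m[OF st(1,2)] by metis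
  then show ?thesis using x by blast
qed

section \<open>The longest element\<close>

abbreviation "w0 \<equiv> longest W S"

text \<open>Every element of maximal length has all reflections as inversions, so it is unique by
  \<open>N_inj\<close>; this justifies the description in \<open>longest\<close>.\<close>

lemma w0: "w0 \<in> carrier W" "N w0 = T"
proof -
  let ?P = "\<lambda>w. w \<in> carrier W \<and> (\<forall>v\<in>carrier W. len v \<le> len w)"
  have top: "N w = T" if "?P w" for w
  proof -
    have "t \<in> N w" if t: "t \<in> T" for t
      using \<open>?P w\<close> len_mult_refl(1)[of t w] t
      by (metis (no_types, lifting) inv_set_def le_neq_implies_less m_closed mem_Collect_eq refl_closed)
    then show ?thesis using N_refl by blast
  qed
  have "\<exists>w. ?P w"
    using finite_has_maximizer[OF fin, of len] one_closed by blast
  then have "\<exists>!w. ?P w" using top N_inj by metis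
  then have "?P w0" unfolding longest_def by (rule theI')
  then show "w0 \<in> carrier W" "N w0 = T" using top by auto
qed

lemma N_w0_mult: "w \<in> carrier W \<Longrightarrow> N (w \<otimes> w0) = T - N w"
  using N_mult[of w w0] w0 N_refl refl_conj'[of _ w] by blast

lemma w0_square: "w0 \<otimes> w0 = \<one>"
  using N_w0_mult[of w0] w0 N_empty by simp

lemma w0_cancel: "w \<in> carrier W \<Longrightarrow> w \<otimes> w0 \<otimes> w0 = w"
  using w0 w0_square by (simp add: m_assoc)

end

section \<open>Congruences of the weak order\<close>

context finite_coxeter begin

abbreviation "wle \<equiv> weak_le W S"

lemma wle_iff: "wle v w \<longleftrightarrow> v \<in> carrier W \<and> w \<in> carrier W \<and> N v \<subseteq> N w"
  by (simp add: weak_le_def)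

lemma wle_refl: "w \<in> carrier W \<Longrightarrow> wle w w"
  by (simp add: wle_iff)

lemma wle_simple: "s \<in> S \<Longrightarrow> w \<in> carrier W \<Longrightarrow> wle s w \<longleftrightarrow> s \<in> N w"
  by (simp add: wle_iff N_S)

lemma wle_w0: "v \<in> carrier W \<Longrightarrow> w \<in> carrier W \<Longrightarrow> wle (w \<otimes> w0) (v \<otimes> w0) \<longleftrightarrow> wle v w"
  using w0 N_refl by (auto simp: wle_iff N_w0_mult)

lemma w0_anti_iso: "order_anti_iso (carrier W) wle (carrier W) wle (\<lambda>w. w \<otimes> w0)"
  unfolding order_anti_iso_def
proof
  show "bij_betw (\<lambda>w. w \<otimes> w0) (carrier W) (carrier W)"
    by (rule bij_betw_byWitness[where f' = "\<lambda>w. w \<otimes> w0"]) (auto simp: w0 w0_cancel)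
qed (simp add: wle_w0)

lemma join_meet_w0:
  assumes "is_join (carrier W) wle x z j" "x \<in> carrier W" "z \<in> carrier W"
  shows "is_meet (carrier W) wle (x \<otimes> w0) (z \<otimes> w0) (j \<otimes> w0)"
  using order_iso_join_meet(1)[OF w0_anti_iso[unfolded order_anti_iso_converse] assms(2,3,1)]
  unfolding is_join_def is_meet_def .

lemma meet_simple:
  assumes "is_meet (carrier W) wle x z j" "s \<in> S"
  shows "s \<in> N j \<longleftrightarrow> s \<in> N x \<and> s \<in> N z"
  using assms wle_simple[of s] unfolding is_meet_def by (metis S_closed wle_iff in_mono)

text \<open>Dual to \<open>meet_simple\<close>: multiplication by \<open>w0\<close> turns the join
  into a meet and complements inversion sets.\<close>

lemma join_simple:
  assumes "is_join (carrier W) wle x z j" "x \<in> carrier W" "z \<in> carrier W" "s \<in> S"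
  shows "s \<in> N j \<longleftrightarrow> s \<in> N x \<or> s \<in> N z"
  using meet_simple[OF join_meet_w0[OF assms(1-3)] assms(4)] assms S_refl
  by (auto simp: N_w0_mult is_join_def)

text \<open>The projection of \<open>j\<close> lies below \<open>y\<close> and \<open>z\<close>,
  hence below their meet \<open>k\<close>.\<close>

lemma meet_parabolic_mono:
  assumes J: "J \<subseteq> S" and j: "is_meet (carrier W) wle x z j" and k: "is_meet (carrier W) wle y z k"
    and x: "N x \<inter> parabolic J \<subseteq> N y \<inter> parabolic J" and y: "y \<in> carrier W" "z \<in> carrier W"
  shows "N j \<inter> parabolic J \<subseteq> N k \<inter> parabolic J"
proof -
  have "j \<in> carrier W" and jx: "wle j x" "wle j z" using j unfolding is_meet_def by auto
  then obtain p where p: "p \<in> parabolic J" "N p = N j \<inter> parabolic J" using parabolic_proj J by blast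
  then have "p \<in> carrier W" using parabolic_closed J by blast
  then have "wle p y" "wle p z" using p jx x y unfolding wle_iff by auto
  then have "wle p k" using k \<open>p \<in> carrier W\<close> unfolding is_meet_def by blast
  then show ?thesis using p by (auto simp: wle_iff)
qed

lemma meet_parabolic_cong:
  assumes "J \<subseteq> S" "is_meet (carrier W) wle x z j" "is_meet (carrier W) wle y z k"
    "N x \<inter> parabolic J = N y \<inter> parabolic J" "x \<in> carrier W" "y \<in> carrier W" "z \<in> carrier W"
  shows "N j \<inter> parabolic J = N k \<inter> parabolic J"
  using meet_parabolic_mono[of J x z j y k] meet_parabolic_mono[of J y z k x j] assms by auto

lemma join_parabolic_cong:
  assumes "J \<subseteq> S" "is_join (carrier W) wle x z j" "is_join (carrier W) wle y z k"
    "N x \<inter> parabolic J = N y \<inter> parabolic J" "x \<in> carrier W" "y \<in> carrier W" "z \<in> carrier W"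
  shows "N j \<inter> parabolic J = N k \<inter> parabolic J"
proof -
  have c: "j \<in> carrier W" "k \<in> carrier W" using assms unfolding is_join_def by auto
  have "(T - N j) \<inter> parabolic J = (T - N k) \<inter> parabolic J"
    using meet_parabolic_cong[OF assms(1) join_meet_w0[OF assms(2)] join_meet_w0[OF assms(3)]] assms c w0
    by (simp add: N_w0_mult) blast
  then show ?thesis using N_refl by blast
qed

text \<open>The classes are the fibres of the map that records whether \<open>s \<le> w\<close>; by
  \<open>join_simple\<close> and \<open>meet_simple\<close> it respects joins and meets in a
  two-element chain.\<close>

lemma simple_congruence:
  assumes "s \<in> S"
  shows "lattice_congruence (carrier W) wle
    {(x, y). x \<in> carrier W \<and> y \<in> carrier W \<and> (s \<in> N x \<longleftrightarrow> s \<in> N y)}" (is "lattice_congruence _ _ ?K")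
proof (rule lattice_congruenceI)
  show "equiv (carrier W) ?K" by (auto simp: equiv_def refl_on_def sym_def trans_def)
  show "(j, k) \<in> ?K" if "(x, y) \<in> ?K" "z \<in> carrier W"
    "is_join (carrier W) wle x z j" "is_join (carrier W) wle y z k" for x y z j k
    using that join_simple[OF that(3)] join_simple[OF that(4)] assms by (auto simp: is_join_def)
  show "(j, k) \<in> ?K" if "(x, y) \<in> ?K" "z \<in> carrier W"
    "is_meet (carrier W) wle x z j" "is_meet (carrier W) wle y z k" for x y z j k
    using that meet_simple[OF that(3)] meet_simple[OF that(4)] assms by (auto simp: is_meet_def)
qed

text \<open>The second alternative describes the elements whose projection lies strictly between the
  identity and the top, on the side of the polygon that starts with \<open>t\<close>.\<close>

definition side_cong :: "'a \<Rightarrow> 'a \<Rightarrow> 'a rel" where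
  "side_cong s t = {(x, y). x \<in> carrier W \<and> y \<in> carrier W \<and>
     (N x \<inter> parabolic {s, t} = N y \<inter> parabolic {s, t} \<or> s \<notin> N x \<and> t \<in> N x \<and> s \<notin> N y \<and> t \<in> N y)}"

text \<open>The congruence is pulled back along the projection to the dihedral parabolic subgroup,
  where it contracts the side of the polygon that starts with \<open>t\<close>.\<close>
lemma side_congruence:
  assumes st: "s \<in> S" "t \<in> S" "s \<noteq> t"
  shows "lattice_congruence (carrier W) wle (side_cong s t)"
proof (rule lattice_congruenceI)
  have J: "{s, t} \<subseteq> S" and m: "s \<in> parabolic {s, t}" "t \<in> parabolic {s, t}" using st parabolic_gen by auto
  have eq: "s \<in> N x \<longleftrightarrow> s \<in> N y" "t \<in> N x \<longleftrightarrow> t \<in> N y"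
    if "N x \<inter> parabolic {s, t} = N y \<inter> parabolic {s, t}" for x y
    using that m by blast+
  show "equiv (carrier W) (side_cong s t)"
  proof (rule equivI)
    show "refl_on (carrier W) (side_cong s t)" by (auto simp: side_cong_def refl_on_def)
    show "sym (side_cong s t)" by (auto simp: side_cong_def sym_def)
    show "trans (side_cong s t)"
    proof (rule transI)
      fix x y z assume "(x, y) \<in> side_cong s t" "(y, z) \<in> side_cong s t"
      then show "(x, z) \<in> side_cong s t"
        using eq[of x y] eq[of y z] unfolding side_cong_def by auto
    qed
  qed (auto simp: side_cong_def)
  show "(j, k) \<in> side_cong s t" if xy: "(x, y) \<in> side_cong s t" and z: "z \<in> carrier W"
    and j: "is_join (carrier W) wle x z j" and k: "is_join (carrier W) wle y z k" for x y z j k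
  proof -
    have c: "x \<in> carrier W" "y \<in> carrier W" "j \<in> carrier W" "k \<in> carrier W"
      using xy j k by (auto simp: side_cong_def is_join_def)
    note js = join_simple[OF j c(1) z] and ks = join_simple[OF k c(2) z]
    show ?thesis
    proof (cases "N x \<inter> parabolic {s, t} = N y \<inter> parabolic {s, t}")
      case True
      then show ?thesis using join_parabolic_cong[OF J j k True] c z by (simp add: side_cong_def)
    next
      case False
      then have f: "s \<notin> N x" "t \<in> N x" "s \<notin> N y" "t \<in> N y" using xy by (auto simp: side_cong_def)
      show ?thesis
      proof (cases "s \<in> N z")
        case True
        \<comment> \<open>Both joins acquire \<open>s\<close> besides \<open>t\<close>, which pushes
          their projections to the top of the polygon.\<close>
        then have "T \<inter> parabolic {s, t} \<subseteq> N j" "T \<inter> parabolic {s, t} \<subseteq> N k"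
          using dihedral_subset st c js ks f by auto
        then have "N j \<inter> parabolic {s, t} = N k \<inter> parabolic {s, t}" using N_refl by blast
        then show ?thesis using c by (simp add: side_cong_def)
      next
        case False
        then show ?thesis using js ks f st c by (simp add: side_cong_def)
      qed
    qed
  qed
  show "(j, k) \<in> side_cong s t" if xy: "(x, y) \<in> side_cong s t" and z: "z \<in> carrier W"
    and j: "is_meet (carrier W) wle x z j" and k: "is_meet (carrier W) wle y z k" for x y z j k
  proof -
    have c: "x \<in> carrier W" "y \<in> carrier W" "j \<in> carrier W" "k \<in> carrier W"
      using xy j k by (auto simp: side_cong_def is_meet_def)
    note js = meet_simple[OF j] and ks = meet_simple[OF k]
    show ?thesis
    proof (cases "N x \<inter> parabolic {s, t} = N y \<inter> parabolic {s, t}")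
      case True
      then show ?thesis using meet_parabolic_cong[OF J j k True] c z by (simp add: side_cong_def)
    next
      case False
      then have f: "s \<notin> N x" "t \<in> N x" "s \<notin> N y" "t \<in> N y" using xy by (auto simp: side_cong_def)
      show ?thesis
      proof (cases "t \<in> N z")
        case True
        then show ?thesis using js ks f st c by (simp add: side_cong_def)
      next
        case False
        \<comment> \<open>Neither meet has \<open>s\<close> or \<open>t\<close> as an inversion, so
          both project to the identity.\<close>
        have "N w \<inter> parabolic {s, t} = {}" if w: "w \<in> carrier W" "s \<notin> N w" "t \<notin> N w" for w
        proof -
          obtain p where p: "p \<in> parabolic {s, t}" "N p = N w \<inter> parabolic {s, t}" using parabolic_proj J w by blast
          then have "p = \<one>" using parabolic_descent[OF J p(1)] w by auto
          then show ?thesis using p by simp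
        qed
        then show ?thesis using js ks f st c False by (simp add: side_cong_def)
      qed
    qed
  qed
qed

lemma one_notin_T: "\<one> \<notin> T"
  using len_mult_refl(1)[of "\<one>" "\<one>"] by auto

end

section \<open>Cambrian lattices\<close>

locale cambrian = finite_coxeter +
  fixes D :: "('a \<times> 'a) set"
  assumes orientation: "orientation W S D"
begin

abbreviation "gens \<equiv> {(t, alt_elem W t s (cox_m W s t - 1)) | s t. (s, t) \<in> D}"
abbreviation "\<Theta> \<equiv> cambrian_cong W S D"
abbreviation "cls \<equiv> cambrian_class W S D"
abbreviation "C \<equiv> cambrian_carrier W S D"
abbreviation "cle \<equiv> cambrian_le W S D"

lemma D_S: "(s, t) \<in> D \<Longrightarrow> s \<in> S \<and> t \<in> S \<and> s \<noteq> t \<and> 2 < cox_m W s t \<and> (t, s) \<notin> D"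
proof -
  assume D: "(s, t) \<in> D"
  then have *: "s \<in> S" "t \<in> S" "2 < cox_m W s t" using orientation unfolding orientation_def by auto
  then have "(t, s) \<notin> D" using D orientation unfolding orientation_def by blast
  with * show ?thesis using cox_m_self[of s] by auto
qed

lemma D_total: "s \<in> S \<Longrightarrow> t \<in> S \<Longrightarrow> 2 < cox_m W s t \<Longrightarrow> (s, t) \<in> D \<or> (t, s) \<in> D"
  using orientation unfolding orientation_def by blast

lemma gens_carrier: "gens \<subseteq> carrier W \<times> carrier W"
  using D_S by (auto simp: alt_elem_alt intro!: alt_closed)

lemma \<Theta>: "lattice_congruence (carrier W) wle \<Theta>" "gens \<subseteq> \<Theta>" "equiv (carrier W) \<Theta>"
  using gen_congruence[OF gens_carrier] lattice_congruenceD(1) unfolding cambrian_cong_def by blast+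

text \<open>Both ends of a generator have \<open>b\<close> as their only simple inversion: the word
  has one letter too few for \<open>a\<close>, and the other simple reflections lie outside the
  dihedral subgroup.\<close>

lemma gens_N:
  assumes D: "(a, b) \<in> D" and r: "r \<in> S"
  defines "x \<equiv> ev (alt b a (cox_m W a b - 1))"
  shows "r \<in> N b \<longleftrightarrow> r \<in> N x" and "N x \<subseteq> parabolic {a, b}"
proof -
  have ab: "a \<in> S" "b \<in> S" "a \<noteq> b" "2 < cox_m W b a" "cox_m W a b = cox_m W b a" "{a, b} \<subseteq> S"
    using D_S[OF D] cox_m_sym[of a b] by auto
  have "x \<in> parabolic {a, b}" unfolding x_def parabolic_def by (intro imageI alt_lists) auto
  then show sub: "N x \<subseteq> parabolic {a, b}" using N_parabolic ab by blast
  have "b \<in> N x" unfolding x_def using alt_N1[of b a] ab by auto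
  moreover have "a \<notin> N x" unfolding x_def using alt_N2[of b a] ab by auto
  moreover have "r \<notin> N x" if "r \<noteq> a" "r \<noteq> b" using sub parabolic_S_mem[of "{a, b}" r] ab r that by blast
  ultimately show "r \<in> N b \<longleftrightarrow> r \<in> N x" using N_S ab by auto
qed

lemma \<Theta>_simple:
  assumes "(x, y) \<in> \<Theta>" "s \<in> S"
  shows "s \<in> N x \<longleftrightarrow> s \<in> N y"
proof -
  have "\<Theta> \<subseteq> {(x, y). x \<in> carrier W \<and> y \<in> carrier W \<and> (s \<in> N x \<longleftrightarrow> s \<in> N y)}"
    unfolding cambrian_cong_def
    by (rule gen_congruence_least[OF simple_congruence[OF assms(2)]])
      (use gens_carrier gens_N[OF _ assms(2)] in \<open>auto simp: alt_elem_alt\<close>)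
  then show ?thesis using assms by blast
qed

text \<open>The generator of an edge \<open>s \<rightarrow> t\<close> runs along the contracted
  side. For any other edge the two dihedral subgroups share at most one simple reflection, so only
  simple inversions survive in the projection, and on these the two ends agree.\<close>

lemma \<Theta>_side:
  assumes st: "s \<in> S" "t \<in> S" "s \<noteq> t" "(t, s) \<notin> D"
  shows "\<Theta> \<subseteq> side_cong s t"
  unfolding cambrian_cong_def
proof (rule gen_congruence_least[OF side_congruence[OF st(1-3)]], safe)
  fix a b assume D: "(a, b) \<in> D"
  define x where "x = ev (alt b a (cox_m W a b - 1))"
  have ab: "a \<in> S" "b \<in> S" "a \<noteq> b" using D_S[OF D] by auto
  note gN = gens_N[OF D, folded x_def]
  have xc: "x \<in> carrier W" unfolding x_def using alt_closed ab by blast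
  have "(b, x) \<in> side_cong s t"
  proof (cases "{a, b} = {s, t}")
    case True
    then have "a = s" "b = t" using D st by (auto simp: doubleton_eq_iff)
    then show ?thesis using gN(1)[of s] gN(1)[of t] N_S ab xc by (auto simp: side_cong_def)
  next
    case False
    obtain r where r: "r \<in> S" "{s, t} \<inter> {a, b} \<subseteq> {r}" using False st ab
      by (cases "s \<in> {a, b}") auto
    have "u \<in> S" if u: "u \<in> T" "u \<in> parabolic {s, t}" "u \<in> parabolic {a, b}" for u
    proof -
      have "u \<in> parabolic ({s, t} \<inter> {a, b})" using parabolic_Int[of "{s, t}" "{a, b}"] u st ab by auto
      then have "u \<in> parabolic {r}" using parabolic_mono[OF r(2)] by blast
      then show ?thesis using parabolic_singleton r u one_notin_T by blast
    qed
    then have "N x \<inter> parabolic {s, t} \<subseteq> S" using gN(2)[OF r(1)] N_refl by blast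
    moreover have "N b \<subseteq> S" using N_S ab by simp
    ultimately have "N b \<inter> parabolic {s, t} = N x \<inter> parabolic {s, t}" using gN(1) by blast
    then show ?thesis using ab xc by (simp add: side_cong_def)
  qed
  then show "(b, alt_elem W b a (cox_m W a b - 1)) \<in> side_cong s t" by (simp add: x_def alt_elem_alt)
qed

section \<open>Order, atoms and sides of the quotient\<close>

lemma C_cls: "C = cls ` carrier W"
  unfolding cambrian_carrier_def cambrian_class_def quotient_def by auto

lemma cls_eq_iff: "x \<in> carrier W \<Longrightarrow> y \<in> carrier W \<Longrightarrow> cls x = cls y \<longleftrightarrow> (x, y) \<in> \<Theta>"
  unfolding cambrian_class_def using eq_equiv_class_iff[OF \<Theta>(3)] by blast

lemma cls_iff: "y \<in> cls x \<longleftrightarrow> (x, y) \<in> \<Theta>"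
  by (simp add: cambrian_class_def)

lemma \<Theta>_carrier: "(x, y) \<in> \<Theta> \<Longrightarrow> x \<in> carrier W \<and> y \<in> carrier W"
  using equiv_type[OF \<Theta>(3)] by blast

lemma \<Theta>_refl: "x \<in> carrier W \<Longrightarrow> (x, x) \<in> \<Theta>" and \<Theta>_sym: "(x, y) \<in> \<Theta> \<Longrightarrow> (y, x) \<in> \<Theta>"
  using \<Theta>(3) by (auto simp: equiv_def refl_on_def sym_def)

lemma cle_iff: "cle X Y \<longleftrightarrow> X \<in> C \<and> Y \<in> C \<and> (\<exists>x\<in>X. \<exists>y\<in>Y. wle x y)"
  unfolding cambrian_le_def cambrian_carrier_def
  using quot_le_iff[of "carrier W" \<Theta> wle] \<Theta>(3) wle_refl by simp

lemma cle_cls: "wle x y \<Longrightarrow> cle (cls x) (cls y)"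
proof -
  assume xy: "wle x y"
  then have "x \<in> carrier W" "y \<in> carrier W" by (auto simp: wle_iff)
  then have "x \<in> cls x" "y \<in> cls y" "cls x \<in> C" "cls y \<in> C" by (auto simp: cls_iff \<Theta>_refl C_cls)
  then show "cle (cls x) (cls y)" using xy cle_iff by blast
qed

text \<open>Congruent elements have the same simple inversions, so the comparison can be tested on
  any representative.\<close>

lemma cle_simple:
  assumes "s \<in> S" "w \<in> carrier W"
  shows "cle (cls s) (cls w) \<longleftrightarrow> s \<in> N w"
proof
  assume "cle (cls s) (cls w)"
  then obtain x y where "(s, x) \<in> \<Theta>" "(w, y) \<in> \<Theta>" "wle x y" by (auto simp: cle_iff cls_iff)
  then show "s \<in> N w" using \<Theta>_simple[of s x s] \<Theta>_simple[of w y s] N_S assms by (auto simp: wle_iff)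
next
  assume "s \<in> N w"
  then show "cle (cls s) (cls w)" using cle_cls wle_simple assms by blast
qed

lemma cls_simple_inj: "s \<in> S \<Longrightarrow> t \<in> S \<Longrightarrow> cls s = cls t \<longleftrightarrow> s = t"
  using cls_eq_iff[of s t] \<Theta>_simple[of s t s] N_S by auto

lemma cls_one: "(\<one>, x) \<in> \<Theta> \<longleftrightarrow> x = \<one>"
proof
  assume x: "(\<one>, x) \<in> \<Theta>"
  then have "x \<in> parabolic S" using \<Theta>_carrier parabolic_S by blast
  then show "x = \<one>" using parabolic_descent[of S x] \<Theta>_simple[OF x] by auto
qed (simp add: \<Theta>_refl)

lemma bottom_cls: "bottom_of C cle X \<longleftrightarrow> X = cls \<one>"
proof
  assume "bottom_of C cle X"
  then have "cle X (cls \<one>)" "X \<in> C" unfolding bottom_of_def C_cls by auto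
  then obtain x where x: "x \<in> X" "wle x \<one>" using cls_one by (auto simp: cle_iff cls_iff)
  then have "x = \<one>" using N_empty by (auto simp: wle_iff)
  moreover obtain w where "w \<in> carrier W" "X = cls w" using \<open>X \<in> C\<close> C_cls by blast
  ultimately show "X = cls \<one>" using x cls_iff cls_eq_iff by (metis one_closed)
next
  assume "X = cls \<one>"
  then show "bottom_of C cle X" unfolding bottom_of_def C_cls using cle_cls by (auto simp: wle_iff)
qed

lemma atoms_cls: "atom_of C cle X \<longleftrightarrow> X \<in> cls ` S"
proof
  assume X: "atom_of C cle X"
  then obtain w where w: "w \<in> carrier W" "X = cls w" unfolding atom_of_def C_cls by blast
  then have "w \<noteq> \<one>" using X bottom_cls unfolding atom_of_def by blast
  then obtain s where s: "s \<in> S" "s \<in> N w" using parabolic_descent[of S w] parabolic_S w by auto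
  then have "cle (cls s) X" "cls s \<in> C" using cle_simple w C_cls by auto
  moreover have "cls s \<noteq> cls \<one>"
    using cls_eq_iff[of s "\<one>"] s cls_one \<Theta>_sym one_notin_S by (metis S_closed one_closed)
  ultimately have "cls s = X" using X bottom_cls unfolding atom_of_def by blast
  then show "X \<in> cls ` S" using s by blast
next
  assume "X \<in> cls ` S"
  then obtain s where s: "s \<in> S" "X = cls s" by blast
  have "cls s \<noteq> cls \<one>"
    using cls_eq_iff[of s "\<one>"] s cls_one \<Theta>_sym one_notin_S by (metis S_closed one_closed)
  moreover have "Z = cls \<one> \<or> Z = cls s" if Z: "cle Z (cls s)" for Z
  proof -
    from Z obtain z y where z: "Z \<in> C" "z \<in> Z" "(s, y) \<in> \<Theta>" "wle z y" by (auto simp: cle_iff cls_iff)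
    then obtain w where w: "w \<in> carrier W" "Z = cls w" using C_cls by blast
    then have Zz: "Z = cls z" using z cls_iff cls_eq_iff \<Theta>_carrier by metis
    have zc: "z \<in> carrier W" using z by (simp add: wle_iff)
    show ?thesis
    proof (cases "z = \<one>")
      case False
      then obtain r where r: "r \<in> S" "r \<in> N z" using parabolic_descent[of S z] parabolic_S zc by auto
      then have "r \<in> N s" using z \<Theta>_simple[of s y r] by (auto simp: wle_iff)
      \<comment> \<open>A nontrivial \<open>z\<close> below a member of the class of
        \<open>s\<close> lies above \<open>s\<close>, so convexity puts it into that class.\<close>
      then have "wle s z" using r N_S s wle_simple zc by auto
      then have "(s, z) \<in> \<Theta>"
        using congruence_convex[OF \<Theta>(1), of s y z] wle_refl z s zc by auto
      then show ?thesis using Zz cls_eq_iff[of s z] s zc by auto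
    qed (use Zz in simp)
  qed
  ultimately show "atom_of C cle X" unfolding atom_of_def bottom_cls s using s C_cls by auto
qed

text \<open>The class of the top element \<open>j\<close> of the dihedral subgroup is the join of
  the two classes. Anything below it can be met with \<open>j\<close> without leaving its class, and
  this meet is the projection to the subgroup.\<close>

lemma side_cls:
  assumes st: "s \<in> S" "t \<in> S" "s \<noteq> t"
  shows "side C cle (cls s) (cls t) = cls ` {x \<in> parabolic {s, t}. s \<in> N x}"
proof (intro equalityI subsetI)
  have J: "{s, t} \<subseteq> S" using st by simp
  fix Z assume "Z \<in> side C cle (cls s) (cls t)"
  then have Z: "Z \<in> C" "cle (cls s) Z" "\<And>V. V \<in> C \<Longrightarrow> cle (cls s) V \<Longrightarrow> cle (cls t) V \<Longrightarrow> cle Z V"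
    by (auto simp: side_def)
  obtain j where j: "j \<in> parabolic {s, t}" "N j = T \<inter> parabolic {s, t}" using parabolic_top J by blast
  have jc: "j \<in> carrier W" using parabolic_closed J j by blast
  have "s \<in> N j" "t \<in> N j" using j parabolic_gen[OF J] S_refl st by auto
  then have "cle Z (cls j)" using Z(3)[of "cls j"] cle_simple jc st C_cls by auto
  then obtain z y where z: "z \<in> Z" "(j, y) \<in> \<Theta>" "wle z y" by (auto simp: cle_iff cls_iff)
  have zc: "z \<in> carrier W" using z by (simp add: wle_iff)
  obtain x where x: "x \<in> parabolic {s, t}" "N x = N z \<inter> parabolic {s, t}" using parabolic_proj J zc by blast
  have xc: "x \<in> carrier W" using parabolic_closed J x by blast
  have "is_meet (carrier W) wle j z x"
    using x j xc jc zc N_refl unfolding is_meet_def wle_iff by auto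
  moreover have "is_meet (carrier W) wle y z z"
    using z zc unfolding is_meet_def wle_iff by auto
  ultimately have xz: "(x, z) \<in> \<Theta>" using lattice_congruenceD(3)[OF \<Theta>(1) z(2) zc] by blast
  obtain w where "w \<in> carrier W" "Z = cls w" using Z(1) C_cls by blast
  then have Zx: "Z = cls x" using z xz cls_iff cls_eq_iff \<Theta>_carrier by metis
  then have "s \<in> N x" using Z(2) cle_simple st xc by simp
  then show "Z \<in> cls ` {x \<in> parabolic {s, t}. s \<in> N x}" using Zx x by blast
next
  have J: "{s, t} \<subseteq> S" using st by simp
  fix Z assume "Z \<in> cls ` {x \<in> parabolic {s, t}. s \<in> N x}"
  then obtain x where x: "x \<in> parabolic {s, t}" "s \<in> N x" "Z = cls x" by blast
  have xc: "x \<in> carrier W" using parabolic_closed J x by blast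
  have "cle Z V" if V: "V \<in> C" "cle (cls s) V" "cle (cls t) V" for V
  proof -
    obtain v where v: "v \<in> carrier W" "V = cls v" using V C_cls by blast
    then have "s \<in> N v" "t \<in> N v" using V cle_simple st by auto
    then have "T \<inter> parabolic {s, t} \<subseteq> N v" using dihedral_subset st v by blast
    then have "wle x v" using N_parabolic[OF J x(1)] N_refl xc v unfolding wle_iff by blast
    then show ?thesis using cle_cls x v by blast
  qed
  then show "Z \<in> side C cle (cls s) (cls t)"
    using x xc C_cls cle_simple[of s x] st by (auto simp: side_def)
qed

lemma parabolic_side:
  assumes st: "s \<in> S" "t \<in> S" "s \<noteq> t"
  shows "{x \<in> parabolic {s, t}. s \<in> N x} = (\<lambda>k. ev (alt s t k)) ` {1..cox_m W s t}"
proof (intro equalityI subsetI)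
  fix x assume "x \<in> {x \<in> parabolic {s, t}. s \<in> N x}"
  then have x: "x \<in> parabolic {s, t}" "s \<in> N x" by auto
  obtain k where k: "k \<le> cox_m W s t" "x = ev (alt s t k) \<or> x = ev (alt t s k)"
    using dihedral_elements st x(1) by blast
  have "x = ev (alt s t k)"
    using k x(2) alt_N2[of t s k] alt_m[of s t] cox_m_sym[of s t] st by (metis le_neq_implies_less)
  moreover have "k \<noteq> 0" using x(2) calculation by (cases k) auto
  ultimately show "x \<in> (\<lambda>k. ev (alt s t k)) ` {1..cox_m W s t}" using k by auto
next
  fix x assume "x \<in> (\<lambda>k. ev (alt s t k)) ` {1..cox_m W s t}"
  then obtain k where k: "1 \<le> k" "k \<le> cox_m W s t" "x = ev (alt s t k)" by auto
  then have "x \<in> parabolic {s, t}" unfolding parabolic_def using alt_lists by (metis image_eqI insertI1 insertI2)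
  then show "x \<in> {x \<in> parabolic {s, t}. s \<in> N x}" using k alt_N1 st by auto
qed

text \<open>Since the edge \<open>t \<rightarrow> s\<close> is excluded, \<Theta> lies in
  \<open>side_cong s t\<close>, which relates elements above \<open>s\<close> only if their
  projections agree. Words of different lengths have different numbers of inversions.\<close>

lemma card_long_side:
  assumes st: "s \<in> S" "t \<in> S" "s \<noteq> t" "(t, s) \<notin> D"
  shows "card (side C cle (cls s) (cls t)) = cox_m W s t"
proof -
  let ?f = "\<lambda>k. ev (alt s t k)"
  have J: "{s, t} \<subseteq> S" using st by simp
  have "inj_on (\<lambda>k. cls (?f k)) {1..cox_m W s t}"
  proof (rule inj_onI)
    fix i k assume ik: "i \<in> {1..cox_m W s t}" "k \<in> {1..cox_m W s t}" "cls (?f i) = cls (?f k)"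
    then have "(?f i, ?f k) \<in> \<Theta>" using cls_eq_iff[of "?f i" "?f k"] alt_closed st by simp
    then have "(?f i, ?f k) \<in> side_cong s t" using \<Theta>_side[OF st] by blast
    moreover have w: "?f i \<in> {x \<in> parabolic {s, t}. s \<in> N x}" "?f k \<in> {x \<in> parabolic {s, t}. s \<in> N x}"
      unfolding parabolic_side[OF st(1-3)] using ik by auto
    moreover have "N (?f i) \<subseteq> parabolic {s, t}" "N (?f k) \<subseteq> parabolic {s, t}" using w N_parabolic[OF J] by simp_all
    ultimately have "N (?f i) = N (?f k)" by (auto simp: side_cong_def Int_absorb2)
    then show "i = k" using N_alt(2)[OF st(1,2)] ik(1,2) by (metis atLeastAtMost_iff)
  qed
  then show ?thesis unfolding side_cls[OF st(1-3)] parabolic_side[OF st(1-3)] image_image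
    by (simp add: card_image)
qed

text \<open>With an edge, one generator and convexity put all words from \<open>t\<close> up to
  length \<open>m(s,t) - 1\<close> into one class; without an edge \<open>m(s,t) = 2\<close> and
  there is one such word. The top stays apart because \<open>s\<close> is an inversion of
  it.\<close>

lemma card_short_side:
  assumes st: "s \<in> S" "t \<in> S" "s \<noteq> t" "(t, s) \<notin> D"
  shows "card (side C cle (cls t) (cls s)) = 2"
proof -
  let ?f = "\<lambda>k. ev (alt t s k)" and ?m = "cox_m W s t"
  have m: "?m \<ge> 2" "cox_m W t s = ?m" using cox_m_ge st cox_m_sym by auto
  have "cls (?f k) = cls t" if k: "1 \<le> k" "k < ?m" for k
  proof (cases "(s, t) \<in> D")
    case True
    then have g: "(t, ?f (?m - 1)) \<in> \<Theta>" using \<Theta>(2) by (auto simp: alt_elem_alt)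
    have "wle t (?f k)" "wle (?f k) (?f (?m - 1))"
      using k m st alt_closed N_alt(1)[of t s k] N_alt(1)[of t s "?m - 1"] alt_N1[of t s k]
      by (auto simp: wle_iff N_S)
    then have "(t, ?f k) \<in> \<Theta>"
      using congruence_convex[OF \<Theta>(1) _ g, of "?f k"] wle_refl st alt_closed by auto
    then show ?thesis using cls_eq_iff[of "?f k" t] \<Theta>_sym st alt_closed by auto
  next
    case False
    then have "?m = 2" using D_total st m by fastforce
    then have "k = Suc 0" using k by auto
    then show ?thesis using st by (simp add: alt_Suc)
  qed
  then have "(\<lambda>k. cls (?f k)) ` {1..<?m} = (\<lambda>k. cls t) ` {1..<?m}" by (intro image_cong) auto
  also have "\<dots> = {cls t}" using m by (simp add: image_constant_conv)
  finally have "(\<lambda>k. cls (?f k)) ` insert ?m {1..<?m} = {cls (?f ?m), cls t}" by simp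
  moreover have "insert ?m {1..<?m} = {1..?m}" using m by auto
  ultimately have "(\<lambda>k. cls (?f k)) ` {1..?m} = {cls (?f ?m), cls t}" by metis
  then have "side C cle (cls t) (cls s) = {cls (?f ?m), cls t}"
    using side_cls[of t s] parabolic_side[of t s] st m by (simp add: image_image)
  moreover have "cls (?f ?m) \<noteq> cls t"
    using cls_eq_iff[of "?f ?m" t] \<Theta>_simple[of "?f ?m" t s] alt_N2m[of t s] st m alt_closed N_S by auto
  ultimately show ?thesis by simp
qed

text \<open>One side is not contracted and has \<open>m(s,t)\<close> elements; the other has 2,
  which is never larger.\<close>

lemma cox_m_side:
  assumes "s \<in> S" "t \<in> S" "s \<noteq> t"
  shows "cox_m W s t = max (card (side C cle (cls s) (cls t))) (card (side C cle (cls t) (cls s)))"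
proof (cases "(t, s) \<in> D")
  case True
  then have "(s, t) \<notin> D" using D_S by blast
  then show ?thesis using card_long_side[of t s] card_short_side[of t s] cox_m_ge[of s t] cox_m_sym[of s t] assms
    by simp
next
  case False
  then show ?thesis using card_long_side card_short_side cox_m_ge assms by simp
qed

lemma D_side:
  assumes "s \<in> S" "t \<in> S" "s \<noteq> t"
  shows "(s, t) \<in> D \<longleftrightarrow> 2 < card (side C cle (cls s) (cls t))"
proof (cases "(t, s) \<in> D")
  case True
  then show ?thesis using D_S[of t s] card_short_side[of t s] assms by simp
next
  case False
  then show ?thesis using card_long_side D_S D_total assms by metis
qed

end

section \<open>Isomorphisms of Coxeter systems\<close>

context coxeter begin

text \<open>Universal property of the presentation. The map is read off from an arbitrarily chosen
  word, and \<open>cong\<close> shows that the choice does not matter.\<close>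

lemma presentation_hom:
  assumes G: "group G" and \<phi>: "\<And>s. s \<in> S \<Longrightarrow> \<phi> s \<in> carrier G"
    and rel: "\<And>s t. s \<in> S \<Longrightarrow> t \<in> S \<Longrightarrow> (\<phi> s \<otimes>\<^bsub>G\<^esub> \<phi> t) [^]\<^bsub>G\<^esub> cox_m W s t = \<one>\<^bsub>G\<^esub>"
  obtains f where "f \<in> hom W G" "\<And>s. s \<in> S \<Longrightarrow> f s = \<phi> s"
proof -
  interpret G: group G by fact
  let ?e = "\<lambda>ws. word_eval G (map \<phi> ws)"
  have l: "map \<phi> ws \<in> lists (carrier G)" if "ws \<in> lists S" for ws
    using that \<phi> by auto
  note e_closed = G.word_eval_closed[OF l]
  have e_append: "?e (xs @ ys) = ?e xs \<otimes>\<^bsub>G\<^esub> ?e ys" if "xs \<in> lists S" "ys \<in> lists S" for xs ys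
    using G.word_eval_append[OF l l] that by simp
  have e_rel: "?e r = \<one>\<^bsub>G\<^esub>" if r: "r \<in> cox_relators W S" for r
  proof -
    from r obtain s t where *: "s \<in> S" "t \<in> S" "r = concat (replicate (cox_m W s t) [s, t])"
      unfolding cox_relators_def by blast
    then have "map \<phi> r = concat (replicate (cox_m W s t) [\<phi> s, \<phi> t])"
      by (simp add: map_concat)
    then show ?thesis using G.word_eval_power[of "\<phi> s" "\<phi> t"] rel * \<phi> by simp
  qed
  have rel_step: "u \<in> lists S \<and> v \<in> lists S \<and> ?e u = ?e v"
    if "rel_step (cox_relators W S) u v" "u \<in> lists S \<or> v \<in> lists S" for u v
  proof -
    from that(1) obtain r x y where *: "r \<in> cox_relators W S" "u = x @ r @ y" "v = x @ y"
      by (auto elim: rel_step.cases)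
    have r: "r \<in> lists S" using relators(1)[OF *(1)] .
    then have xy: "x \<in> lists S" "y \<in> lists S" using that(2) * by auto
    then have ry: "r @ y \<in> lists S" using r by simp
    have "?e (r @ y) = ?e y" unfolding e_append[OF r xy(2)] e_rel[OF *(1)] using e_closed[OF xy(2)] by simp
    then have "?e u = ?e v"
      unfolding *(2,3) e_append[OF xy(1) ry] e_append[OF xy] by simp
    then show ?thesis using * r xy by simp
  qed
  have equiv: "v \<in> lists S \<and> ?e u = ?e v"
    if "pres_equiv (cox_relators W S) u v" "u \<in> lists S" for u v
    using that(1) unfolding pres_equiv_def
  proof (induction rule: rtranclp_induct)
    case (step v w)
    then show ?case using rel_step
      by (metis (no_types, lifting) conversep_iff sup2E)
  qed (use that in auto)
  have one: "?e ws = \<one>\<^bsub>G\<^esub>" if "ws \<in> lists S" "ev ws = \<one>" for ws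
    using equiv[of ws "[]"] presentation[of ws] that by (simp add: word_eval_def)
  \<comment> \<open>Two words for one element are compared by appending the same inverse word and
    cancelling its image.\<close>
  have cong: "?e us = ?e ws" if us: "us \<in> lists S" and ws: "ws \<in> lists S" and eq: "ev us = ev ws" for us ws
  proof -
    have r: "rev ws \<in> lists S" using ws by auto
    have "ev (us @ rev ws) = \<one>" "ev (ws @ rev ws) = \<one>"
      using us ws r eq by (simp_all only: ev_append_S ev_rev r_inv ev_closed_S)
    then have "?e (us @ rev ws) = \<one>\<^bsub>G\<^esub>" "?e (ws @ rev ws) = \<one>\<^bsub>G\<^esub>"
      using us ws r by (simp_all only: one append_in_lists_conv)
    then have "?e us \<otimes>\<^bsub>G\<^esub> ?e (rev ws) = ?e ws \<otimes>\<^bsub>G\<^esub> ?e (rev ws)"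
      using e_append us ws r by metis
    then show ?thesis using e_closed us ws r by simp
  qed
  define f where "f w = ?e (SOME ws. ws \<in> lists S \<and> ev ws = w)" for w
  have f: "f (ev ws) = ?e ws" if "ws \<in> lists S" for ws
  proof -
    have "(SOME vs. vs \<in> lists S \<and> ev vs = ev ws) \<in> lists S \<and> ev (SOME vs. vs \<in> lists S \<and> ev vs = ev ws) = ev ws"
      by (rule someI[of _ ws]) (use that in simp)
    then show ?thesis unfolding f_def using cong that by blast
  qed
  have "f \<in> hom W G"
  proof (rule homI)
    fix x y assume xy: "x \<in> carrier W" "y \<in> carrier W"
    then obtain xs ys where w: "xs \<in> lists S" "ev xs = x" "ys \<in> lists S" "ev ys = y"
      using words_onto by metis
    then show "f x \<in> carrier G" using f e_closed by metis
    have "f (ev (xs @ ys)) = ?e (xs @ ys)" using w by (intro f) simp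
    then show "f (x \<otimes> y) = f x \<otimes>\<^bsub>G\<^esub> f y"
      using w f e_append ev_append_S by metis
  qed
  moreover have "f s = \<phi> s" if "s \<in> S" for s
    using f[of "[s]"] that \<phi> by (simp add: word_eval_def)
  ultimately show ?thesis using that by blast
qed

lemma hom_word:
  assumes "group G" "f \<in> hom W G" "ws \<in> lists S"
  shows "f (ev ws) = word_eval G (map f ws)"
  using assms(3)
proof induction
  case Nil
  interpret group_hom W G f
    using assms by (intro group_hom.intro group_hom_axioms.intro is_group)
  show ?case by (simp add: word_eval_def)
next
  case (Cons a l)
  then show ?case using assms(2) by (simp add: hom_mult word_eval_def[of G])
qed

end

lemma finite_coxeterI: "finite_coxeter_system W S \<Longrightarrow> finite_coxeter W S"
  unfolding finite_coxeter_system_def coxeter_system_def finite_coxeter_def coxeter_def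
    coxeter_axioms_def finite_coxeter_axioms_def by blast

text \<open>The maps are assumed inverse on generators, which is what a diagram isomorphism
  provides; \<open>gf\<close> extends this to the groups. The assumptions are symmetric, so the
  sublocale transfers facts on \<open>f\<close> to \<open>g\<close>.\<close>

locale coxeter_iso = A: coxeter W1 S1 + B: coxeter W2 S2
  for W1 :: "('a, 'm) monoid_scheme" and S1 and W2 :: "('b, 'n) monoid_scheme" and S2 +
  fixes f g
  assumes f_hom: "f \<in> hom W1 W2" and g_hom: "g \<in> hom W2 W1"
    and f_S: "s \<in> S1 \<Longrightarrow> f s \<in> S2" and g_S: "t \<in> S2 \<Longrightarrow> g t \<in> S1"
    and gf_S: "s \<in> S1 \<Longrightarrow> g (f s) = s" and fg_S: "t \<in> S2 \<Longrightarrow> f (g t) = t"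
begin

lemma f_word: "ws \<in> lists S1 \<Longrightarrow> f (word_eval W1 ws) = word_eval W2 (map f ws)"
  by (rule A.hom_word) (auto simp: f_hom B.is_group)

lemma g_word: "ws \<in> lists S2 \<Longrightarrow> g (word_eval W2 ws) = word_eval W1 (map g ws)"
  by (rule B.hom_word) (auto simp: g_hom A.is_group)

lemma gf: "x \<in> carrier W1 \<Longrightarrow> g (f x) = x"
proof -
  assume "x \<in> carrier W1"
  then obtain ws where ws: "ws \<in> lists S1" "word_eval W1 ws = x" using A.words_onto by blast
  moreover have "map f ws \<in> lists S2" using ws f_S by auto
  moreover have "map g (map f ws) = ws" using ws gf_S by (auto simp: map_idI)
  ultimately show ?thesis using f_word g_word by metis
qed

lemma f_closed: "x \<in> carrier W1 \<Longrightarrow> f x \<in> carrier W2"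
  using f_hom by (simp add: hom_in_carrier)

lemma len_f_le: "x \<in> carrier W1 \<Longrightarrow> cox_len W2 S2 (f x) \<le> cox_len W1 S1 x"
proof -
  assume "x \<in> carrier W1"
  then obtain ws where ws: "ws \<in> lists S1" "length ws = cox_len W1 S1 x" "word_eval W1 ws = x"
    using A.len_word by blast
  moreover have "map f ws \<in> lists S2" using ws f_S by auto
  ultimately show ?thesis using f_word B.len_le by (metis length_map)
qed

lemma f_refl: "t \<in> reflections W1 S1 \<Longrightarrow> f t \<in> reflections W2 S2"
proof -
  interpret f: group_hom W1 W2 f
    by (intro group_hom.intro group_hom_axioms.intro f_hom A.is_group B.is_group)
  assume "t \<in> reflections W1 S1"
  then obtain w s where "w \<in> carrier W1" "s \<in> S1" "t = w \<otimes>\<^bsub>W1\<^esub> s \<otimes>\<^bsub>W1\<^esub> inv\<^bsub>W1\<^esub> w"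
    using A.refl_iff by blast
  moreover from this have "f t = f w \<otimes>\<^bsub>W2\<^esub> f s \<otimes>\<^bsub>W2\<^esub> inv\<^bsub>W2\<^esub> (f w)" by simp
  ultimately show ?thesis using B.refl_iff f_S f_closed by blast
qed

lemma f_alt:
  assumes "s \<in> S1" "t \<in> S1"
  shows "f (alt_elem W1 s t k) = alt_elem W2 (f s) (f t) k"
proof -
  have "map f (map (\<lambda>i. if even i then s else t) [0..<k]) = map (\<lambda>i. if even i then f s else f t) [0..<k]"
    by simp
  moreover have "map (\<lambda>i. if even i then s else t) [0..<k] \<in> lists S1" using assms by auto
  ultimately show ?thesis unfolding alt_elem_def using f_word by metis
qed

end

sublocale coxeter_iso \<subseteq> inverse: coxeter_iso W2 S2 W1 S1 g f
  by unfold_locales (auto simp: f_hom g_hom f_S g_S gf_S fg_S)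

context coxeter_iso begin

lemma len_f: "x \<in> carrier W1 \<Longrightarrow> cox_len W2 S2 (f x) = cox_len W1 S1 x"
  using len_f_le inverse.len_f_le[OF f_closed] gf by (metis le_antisym)

lemma f_inv_set: "x \<in> carrier W1 \<Longrightarrow> inv_set W2 S2 (f x) = f ` inv_set W1 S1 x"
proof -
  assume x: "x \<in> carrier W1"
  have *: "f t \<in> inv_set W2 S2 (f x) \<longleftrightarrow> t \<in> inv_set W1 S1 x" if "t \<in> reflections W1 S1" for t
  proof -
    have t: "t \<in> carrier W1" using that by simp
    then have "f t \<otimes>\<^bsub>W2\<^esub> f x = f (t \<otimes>\<^bsub>W1\<^esub> x)" using f_hom x by (simp add: hom_mult)
    then show ?thesis using that f_refl t x by (simp add: inv_set_def len_f)
  qed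
  have "y \<in> f ` inv_set W1 S1 x" if "y \<in> inv_set W2 S2 (f x)" for y
  proof -
    have "y \<in> reflections W2 S2" using that B.N_refl by blast
    then have "f (g y) = y" "g y \<in> reflections W1 S1" using inverse.gf inverse.f_refl by auto
    then show ?thesis using * that by (metis image_eqI)
  qed
  then show ?thesis using * A.N_refl by blast
qed

lemma f_order_iso: "order_iso (carrier W1) (weak_le W1 S1) (carrier W2) (weak_le W2 S2) f"
  unfolding order_iso_def
proof (intro conjI ballI)
  show bij: "bij_betw f (carrier W1) (carrier W2)"
    by (rule bij_betw_byWitness[where f' = g]) (auto simp: gf inverse.gf f_closed inverse.f_closed)
  fix x y assume xy: "x \<in> carrier W1" "y \<in> carrier W1"
  have "g (f t) = t" if "t \<in> inv_set W1 S1 z" for t z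
    by (rule gf[OF A.refl_closed[OF subsetD[OF A.N_refl that]]])
  then have "g ` f ` inv_set W1 S1 z = inv_set W1 S1 z" for z
    by (simp add: image_image)
  then have "f ` inv_set W1 S1 x \<subseteq> f ` inv_set W1 S1 y \<longleftrightarrow> inv_set W1 S1 x \<subseteq> inv_set W1 S1 y"
    by (metis image_mono)
  then show "weak_le W1 S1 x y \<longleftrightarrow> weak_le W2 S2 (f x) (f y)"
    using xy by (simp add: weak_le_def f_closed f_inv_set)
qed

end

text \<open>A diagram isomorphism speaks only of labels above 2. For distinct generators the
  remaining value is 2, as finiteness excludes order 0, and for equal ones it is 1.\<close>

lemma diagram_iso_cox_m:
  assumes "finite_coxeter W1 S1" "finite_coxeter W2 S2" "diagram_iso W1 S1 D1 W2 S2 D2 \<phi>"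
    "s \<in> S1" "t \<in> S1"
  shows "cox_m W2 (\<phi> s) (\<phi> t) = cox_m W1 s t"
proof -
  interpret A: finite_coxeter W1 S1 by fact
  interpret B: finite_coxeter W2 S2 by fact
  have \<phi>: "bij_betw \<phi> S1 S2" using assms(3) unfolding diagram_iso_def by blast
  have m: "cox_m W1 s t > 2 \<longleftrightarrow> cox_m W2 (\<phi> s) (\<phi> t) > 2"
    "cox_m W1 s t > 2 \<longrightarrow> cox_m W2 (\<phi> s) (\<phi> t) = cox_m W1 s t"
    using assms(3-5) unfolding diagram_iso_def by blast+
  have S2: "\<phi> s \<in> S2" "\<phi> t \<in> S2" using \<phi> assms by (auto simp: bij_betw_def)
  show ?thesis
  proof (cases "s = t")
    case True
    then show ?thesis using A.cox_m_self B.cox_m_self S2 assms by simp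
  next
    case False
    then have "\<phi> s \<noteq> \<phi> t" using \<phi> assms by (auto simp: bij_betw_def inj_on_def)
    then show ?thesis using A.cox_m_ge[of s t] B.cox_m_ge[of "\<phi> s" "\<phi> t"] m S2 False assms by linarith
  qed
qed

lemma diagram_iso_inverse:
  assumes "diagram_iso W1 S1 D1 W2 S2 D2 \<phi>"
  shows "diagram_iso W2 S2 D2 W1 S1 D1 (inv_into S1 \<phi>)"
proof -
  have \<phi>: "bij_betw \<phi> S1 S2" using assms unfolding diagram_iso_def by blast
  then have "inv_into S1 \<phi> s \<in> S1" "\<phi> (inv_into S1 \<phi> s) = s" if "s \<in> S2" for s
    using that by (auto simp: bij_betw_def inv_into_into f_inv_into_f)
  then show ?thesis using assms bij_betw_inv_into[OF \<phi>] unfolding diagram_iso_def by metis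
qed

lemma diagram_group_iso:
  assumes W1: "finite_coxeter W1 S1" and W2: "finite_coxeter W2 S2"
    and \<phi>: "diagram_iso W1 S1 D1 W2 S2 D2 \<phi>"
  obtains f g where "coxeter_iso W1 S1 W2 S2 f g" "\<And>s. s \<in> S1 \<Longrightarrow> f s = \<phi> s"
    "\<And>t. t \<in> S2 \<Longrightarrow> g t = inv_into S1 \<phi> t"
proof -
  interpret A: finite_coxeter W1 S1 by fact
  interpret B: finite_coxeter W2 S2 by fact
  let ?\<psi> = "inv_into S1 \<phi>"
  note \<psi> = diagram_iso_inverse[OF \<phi>]
  have b: "bij_betw \<phi> S1 S2" using \<phi> unfolding diagram_iso_def by blast
  have S: "\<phi> s \<in> S2" "?\<psi> (\<phi> s) = s" if "s \<in> S1" for s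
    using that b by (auto simp: bij_betw_def)
  have S': "?\<psi> t \<in> S1" "\<phi> (?\<psi> t) = t" if "t \<in> S2" for t
    using that b by (auto simp: bij_betw_def inv_into_into f_inv_into_f)
  obtain f where f: "f \<in> hom W1 W2" "\<And>s. s \<in> S1 \<Longrightarrow> f s = \<phi> s"
  proof (rule A.presentation_hom[of W2 \<phi>])
    fix s t assume "s \<in> S1" "t \<in> S1"
    then show "(\<phi> s \<otimes>\<^bsub>W2\<^esub> \<phi> t) [^]\<^bsub>W2\<^esub> cox_m W1 s t = \<one>\<^bsub>W2\<^esub>"
      using diagram_iso_cox_m[OF W1 W2 \<phi>, of s t] S B.pow_ord_eq_1[of "\<phi> s \<otimes>\<^bsub>W2\<^esub> \<phi> t"]
      unfolding cox_m_def by simp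
  qed (use S B.is_group in auto)
  obtain g where g: "g \<in> hom W2 W1" "\<And>t. t \<in> S2 \<Longrightarrow> g t = ?\<psi> t"
  proof (rule B.presentation_hom[of W1 ?\<psi>])
    fix s t assume "s \<in> S2" "t \<in> S2"
    then show "(?\<psi> s \<otimes>\<^bsub>W1\<^esub> ?\<psi> t) [^]\<^bsub>W1\<^esub> cox_m W2 s t = \<one>\<^bsub>W1\<^esub>"
      using diagram_iso_cox_m[OF W2 W1 \<psi>, of s t] S' A.pow_ord_eq_1[of "?\<psi> s \<otimes>\<^bsub>W1\<^esub> ?\<psi> t"]
      unfolding cox_m_def by simp
  qed (use S' A.is_group in auto)
  have "coxeter_iso W1 S1 W2 S2 f g"
    by unfold_locales (use f g S S' in auto)
  then show ?thesis using that f g by blast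
qed

lemma diagram_iso_gens:
  assumes "cambrian W1 S1 D1" and "cambrian W2 S2 D2"
    and \<phi>: "diagram_iso W1 S1 D1 W2 S2 D2 \<phi>"
    and f: "coxeter_iso W1 S1 W2 S2 f g" "\<And>s. s \<in> S1 \<Longrightarrow> f s = \<phi> s"
    and xy: "(x, y) \<in> {(t, alt_elem W1 t s (cox_m W1 s t - 1)) | s t. (s, t) \<in> D1}"
  shows "(f x, f y) \<in> cambrian_cong W2 S2 D2"
proof -
  interpret A: cambrian W1 S1 D1 by fact
  interpret B: cambrian W2 S2 D2 by fact
  interpret coxeter_iso W1 S1 W2 S2 f g by fact
  from xy obtain s t where st: "(s, t) \<in> D1" "x = t" "y = alt_elem W1 t s (cox_m W1 s t - 1)" by blast
  have S: "s \<in> S1" "t \<in> S1" using A.D_S st by auto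
  then have "f y = alt_elem W2 (\<phi> t) (\<phi> s) (cox_m W2 (\<phi> s) (\<phi> t) - 1)"
    using st f_alt f(2)
      diagram_iso_cox_m[OF A.finite_coxeter_axioms B.finite_coxeter_axioms \<phi>] by simp
  moreover have "(\<phi> s, \<phi> t) \<in> D2" using \<phi> st S unfolding diagram_iso_def by blast
  ultimately have "(f x, f y) \<in> B.gens" using st S f(2) by auto
  then show ?thesis using B.\<Theta>(2) by blast
qed

theorem diagram_iso_cambrian_iso:
  assumes A: "cambrian W1 S1 D1" and B: "cambrian W2 S2 D2"
    and \<phi>: "diagram_iso W1 S1 D1 W2 S2 D2 \<phi>"
  obtains F where "order_iso (cambrian_carrier W1 S1 D1) (cambrian_le W1 S1 D1)
      (cambrian_carrier W2 S2 D2) (cambrian_le W2 S2 D2) F"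
    "\<And>s. s \<in> S1 \<Longrightarrow> F (cambrian_class W1 S1 D1 s) = cambrian_class W2 S2 D2 (\<phi> s)"
proof -
  interpret A: cambrian W1 S1 D1 by fact
  interpret B: cambrian W2 S2 D2 by fact
  obtain f g where fg: "coxeter_iso W1 S1 W2 S2 f g" and f: "\<And>s. s \<in> S1 \<Longrightarrow> f s = \<phi> s"
    and g: "\<And>t. t \<in> S2 \<Longrightarrow> g t = inv_into S1 \<phi> t"
    using diagram_group_iso[OF A.finite_coxeter_axioms B.finite_coxeter_axioms \<phi>] by blast
  interpret coxeter_iso W1 S1 W2 S2 f g by fact
  have P: "(f x, f y) \<in> gen_congruence (carrier W2) B.wle B.gens" if "(x, y) \<in> A.gens" for x y
    using diagram_iso_gens[OF A B \<phi> fg f that] unfolding cambrian_cong_def .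
  have Q: "(g x, g y) \<in> gen_congruence (carrier W1) A.wle A.gens" if "(x, y) \<in> B.gens" for x y
    using diagram_iso_gens[OF B A diagram_iso_inverse[OF \<phi>] inverse.coxeter_iso_axioms g that]
    unfolding cambrian_cong_def .
  note q = quotient_order_iso[OF f_order_iso inverse.f_order_iso inverse.gf A.wle_refl B.wle_refl
      A.gens_carrier B.gens_carrier P Q, folded cambrian_cong_def]
  show ?thesis
  proof (rule that[of "\<lambda>X. f ` X"])
    show "order_iso (cambrian_carrier W1 S1 D1) (cambrian_le W1 S1 D1)
      (cambrian_carrier W2 S2 D2) (cambrian_le W2 S2 D2) (\<lambda>X. f ` X)"
      unfolding cambrian_carrier_def cambrian_le_def using q(1) by blast
    show "f ` cambrian_class W1 S1 D1 s = cambrian_class W2 S2 D2 (\<phi> s)" if "s \<in> S1" for s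
      unfolding cambrian_class_def using q(2)[of s] f that by simp
  qed
qed

section \<open>The anti-isomorphism given by the longest element\<close>

context finite_coxeter begin

text \<open>A reflection of the subgroup is an inversion of \<open>w\<close>, and so is its
  conjugate by \<open>w\<close>; in the cocycle rule for \<open>w w\<close> the two cancel.\<close>

lemma parabolic_top_square:
  assumes J: "J \<subseteq> S" and w: "w \<in> parabolic J" "N w = T \<inter> parabolic J"
  shows "w \<otimes> w = \<one>"
proof -
  have wc: "w \<in> carrier W" using parabolic_closed J w by blast
  have "r \<notin> N (w \<otimes> w)" if r: "r \<in> T" for r
  proof (cases "r \<in> parabolic J")
    case True
    then have "inv w \<otimes> r \<otimes> w \<in> N w" using w J r wc refl_conj' by (auto intro!: parabolic_mult parabolic_inv)
    then show ?thesis using N_mult[of w w r] w wc r True by auto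
  next
    case False
    then have "w \<otimes> w \<in> parabolic J" "r \<notin> parabolic J" using w J parabolic_mult by auto
    then show ?thesis using N_parabolic J by blast
  qed
  then have "N (w \<otimes> w) = {}" using N_refl by blast
  then show ?thesis using N_empty wc by simp
qed

text \<open>The interval from \<open>w w0\<close> up to \<open>w0\<close> is a translate of the parabolic subgroup.\<close>
lemma join_translate:
  assumes J: "J \<subseteq> S" and w: "w \<in> parabolic J" "N w = T \<inter> parabolic J" and x: "x \<in> parabolic J"
  shows "is_join (carrier W) wle x (w \<otimes> w0) (x \<otimes> (w \<otimes> w0))"
proof -
  have c: "w \<in> carrier W" "x \<in> carrier W" using parabolic_closed J w x by auto
  have u: "N (w \<otimes> w0) = T - parabolic J" using N_w0_mult c w by auto
  have "r \<in> N (x \<otimes> (w \<otimes> w0)) \<longleftrightarrow> r \<in> N x \<union> N (w \<otimes> w0)" if r: "r \<in> T" for r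
  proof -
    \<comment> \<open>Conjugation by \<open>x\<close> preserves \<open>parabolic J\<close>, so the
      second term of the cocycle rule is \<open>T - parabolic J\<close>, which is disjoint from
      \<open>N x\<close>.\<close>
    have "inv x \<otimes> r \<otimes> x \<in> parabolic J \<longleftrightarrow> r \<in> parabolic J"
    proof
      assume a: "inv x \<otimes> r \<otimes> x \<in> parabolic J"
      have "r = x \<otimes> (inv x \<otimes> r \<otimes> x) \<otimes> inv x" using r c by (simp add: m_assoc)
      also have "\<dots> \<in> parabolic J" by (rule parabolic_mult[OF J parabolic_mult[OF J x a] parabolic_inv[OF J x]])
      finally show "r \<in> parabolic J" .
    qed (use J x in \<open>auto intro!: parabolic_mult parabolic_inv\<close>)
    moreover have "r \<in> N x \<Longrightarrow> r \<in> parabolic J" using N_parabolic J x by blast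
    ultimately show ?thesis using N_mult[of x "w \<otimes> w0" r] u c w0 r refl_conj'[of r x] by auto
  qed
  then have "N (x \<otimes> (w \<otimes> w0)) = N x \<union> N (w \<otimes> w0)" using N_refl by blast
  then show ?thesis using c w0 unfolding is_join_def wle_iff by auto
qed

end

context cambrian begin

lemma cambrian_converse: "cambrian W S (D\<inverse>)"
proof unfold_locales
  show "orientation W S (D\<inverse>)"
    unfolding orientation_def
  proof (intro conjI ballI impI)
    show "D\<inverse> \<subseteq> S \<times> S" using D_S by auto
    show "case x of (s, t) \<Rightarrow> 2 < cox_m W s t" if "x \<in> D\<inverse>" for x
    proof (cases x)
      case (Pair s t)
      then have "(t, s) \<in> D" using that by simp
      from D_S[OF this] Pair cox_m_sym[of s t] show ?thesis by simp
    qed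
    show "(s, t) \<in> D\<inverse> \<longleftrightarrow> (t, s) \<notin> D\<inverse>" if "s \<in> S" "t \<in> S" "2 < cox_m W s t" for s t
      using D_S[of s t] D_total[OF that] by auto
  qed
qed

text \<open>The generator of the edge \<open>t \<rightarrow> s\<close> pairs \<open>s\<close> with
  \<open>t w\<close>, where \<open>w\<close> is the top of the dihedral subgroup. Joining both with
  \<open>w w0\<close> gives \<open>s w w0\<close> and \<open>t w w w0 = t w0\<close>, and
  \<open>s w\<close> is the alternating word from \<open>t\<close> with one letter less than
  \<open>w\<close>.\<close>

lemma top_gens:
  assumes D: "(t, s) \<in> D"
  shows "(t \<otimes> w0, alt_elem W t s (cox_m W s t - 1) \<otimes> w0) \<in> \<Theta>"
proof -
  have st: "s \<in> S" "t \<in> S" "s \<noteq> t" "2 < cox_m W s t" "cox_m W t s = cox_m W s t"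
    and J: "{s, t} \<subseteq> S" using D_S[OF D] cox_m_sym by auto
  define k where "k = cox_m W s t - 1"
  then have k: "cox_m W s t = Suc k" using st by simp
  define w where "w = ev (alt s t (Suc k))"
  have w1: "w = s \<otimes> ev (alt t s k)" by (simp add: w_def alt_Suc)
  have w2: "w = t \<otimes> ev (alt s t k)" using alt_m[OF st(1,2)] by (simp add: w_def k alt_Suc)
  have alt_parabolic: "ev (alt s t j) \<in> parabolic {s, t}" for j
    unfolding parabolic_def by (intro imageI alt_lists) simp_all
  have w: "w \<in> parabolic {s, t}" "N w = T \<inter> parabolic {s, t}"
    unfolding w_def using alt_parabolic dihedral_top[OF st(1-3)] unfolding k by blast+
  have c: "w \<in> carrier W" "ev (alt t s k) \<in> carrier W" "ev (alt s t k) \<in> carrier W"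
    using parabolic_closed[OF J w(1)] alt_closed st by auto
  have sq: "w \<otimes> (w \<otimes> w0) = w0" using parabolic_top_square[OF J w] c w0 by (metis l_one m_assoc)
  have x: "s \<in> parabolic {s, t}" "ev (alt s t k) \<in> parabolic {s, t}"
    using parabolic_gen[OF J] alt_parabolic by simp_all
  have "(s, alt_elem W s t (cox_m W t s - 1)) \<in> gens" using D by blast
  then have "(s, alt_elem W s t (cox_m W t s - 1)) \<in> \<Theta>" using \<Theta>(2) by blast
  then have "(s, ev (alt s t k)) \<in> \<Theta>" using st by (simp add: alt_elem_alt k_def)
  from lattice_congruenceD(2)[OF \<Theta>(1) this _ join_translate[OF J w x(1)] join_translate[OF J w x(2)]]
  have "(s \<otimes> (w \<otimes> w0), ev (alt s t k) \<otimes> (w \<otimes> w0)) \<in> \<Theta>" using c w0 by simp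
  moreover have "s \<otimes> (w \<otimes> w0) = ev (alt t s k) \<otimes> w0"
    unfolding w1 using st c w0 by (simp add: m_assoc)
  moreover have "ev (alt s t k) \<otimes> (w \<otimes> w0) = t \<otimes> w0"
  proof -
    have "ev (alt s t k) = t \<otimes> w" unfolding w2 using st c by simp
    then show ?thesis using sq st c w0 by (simp add: m_assoc)
  qed
  ultimately show ?thesis using \<Theta>_sym by (simp add: alt_elem_alt k_def)
qed

text \<open>\<open>quotient_order_iso\<close> is applied with one order reversed and with
  multiplication by the involution \<open>w0\<close> in both directions; \<open>top_gens\<close> for
  the two opposite orientations matches the generators.\<close>

theorem w0_cambrian_anti_iso:
  shows "order_anti_iso (cambrian_carrier W S (D\<inverse>)) (cambrian_le W S (D\<inverse>)) C cle (\<lambda>X. (\<lambda>w. w \<otimes> w0) ` X)"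
    and "x \<in> carrier W \<Longrightarrow> (\<lambda>w. w \<otimes> w0) ` cambrian_class W S (D\<inverse>) x = cls (x \<otimes> w0)"
proof -
  interpret R: cambrian W S "D\<inverse>" by (rule cambrian_converse)
  note i = w0_anti_iso[unfolded order_anti_iso_converse]
  have j: "order_iso (carrier W) (\<lambda>x y. wle y x) (carrier W) wle (\<lambda>w. w \<otimes> w0)"
    using i unfolding order_iso_def by auto
  have P: "(x \<otimes> w0, y \<otimes> w0) \<in> gen_congruence (carrier W) (\<lambda>x y. wle y x) gens"
    if "(x, y) \<in> R.gens" for x y
    using that top_gens unfolding gen_congruence_converse[where lr = wle] cambrian_cong_def[symmetric] by auto
  have Q: "(x \<otimes> w0, y \<otimes> w0) \<in> gen_congruence (carrier W) wle R.gens"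
    if "(x, y) \<in> gens" for x y
    using that R.top_gens unfolding cambrian_cong_def[symmetric] by auto
  note q = quotient_order_iso[OF i j w0_cancel wle_refl wle_refl R.gens_carrier gens_carrier P Q,
      unfolded gen_congruence_converse[where lr = wle], folded cambrian_cong_def]
  have le: "(\<lambda>X Y. quot_le (carrier W) wle \<Theta> Y X) = quot_le (carrier W) (\<lambda>x y. wle y x) \<Theta>"
    using quot_le_converse[of "carrier W" \<Theta> wle] \<Theta>(3) wle_refl by (intro ext) blast
  show "order_anti_iso (cambrian_carrier W S (D\<inverse>)) (cambrian_le W S (D\<inverse>)) C cle (\<lambda>X. (\<lambda>w. w \<otimes> w0) ` X)"
    using q(1) unfolding order_anti_iso_converse cambrian_carrier_def cambrian_le_def le by blast
  show "x \<in> carrier W \<Longrightarrow> (\<lambda>w. w \<otimes> w0) ` cambrian_class W S (D\<inverse>) x = cls (x \<otimes> w0)"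
    unfolding cambrian_class_def using q(2) by blast
qed

end

section \<open>Recovering the diagram from the lattice\<close>

text \<open>Atoms and the sizes of the sides they span are invariants of the order;
  \<open>cox_m_side\<close> and \<open>D_side\<close> read labels and directions off them.\<close>

theorem cambrian_iso_diagram_iso:
  assumes A: "cambrian W1 S1 D1" and B: "cambrian W2 S2 D2"
    and F: "order_iso (cambrian_carrier W1 S1 D1) (cambrian_le W1 S1 D1)
      (cambrian_carrier W2 S2 D2) (cambrian_le W2 S2 D2) F"
  obtains \<phi> where "diagram_iso W1 S1 D1 W2 S2 D2 \<phi>"
    "\<And>s. s \<in> S1 \<Longrightarrow> F (cambrian_class W1 S1 D1 s) = cambrian_class W2 S2 D2 (\<phi> s)"
proof -
  interpret A: cambrian W1 S1 D1 by fact
  interpret B: cambrian W2 S2 D2 by fact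
  have bF: "bij_betw F A.C B.C" using F unfolding order_iso_def by blast
  have AC: "A.cls s \<in> A.C" if "s \<in> S1" for s using that A.C_cls by auto
  have BC: "B.cls s \<in> B.C" if "s \<in> S2" for s using that B.C_cls by auto
  have "\<forall>s\<in>S1. \<exists>r. r \<in> S2 \<and> F (A.cls s) = B.cls r"
  proof
    fix s assume "s \<in> S1"
    then have "atom_of B.C B.cle (F (A.cls s))" using order_iso_atom[OF F] A.atoms_cls AC by blast
    then show "\<exists>r. r \<in> S2 \<and> F (A.cls s) = B.cls r" using B.atoms_cls by blast
  qed
  then obtain \<phi> where \<phi>: "\<And>s. s \<in> S1 \<Longrightarrow> \<phi> s \<in> S2" "\<And>s. s \<in> S1 \<Longrightarrow> F (A.cls s) = B.cls (\<phi> s)" by metis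
  have inj: "inj_on \<phi> S1"
    by (rule inj_onI) (metis \<phi>(2) A.cls_simple_inj AC bF bij_betw_inv_into_left)
  have "r \<in> \<phi> ` S1" if r: "r \<in> S2" for r
  proof -
    obtain X where X: "X \<in> A.C" "F X = B.cls r" using bF BC[OF r] by (metis bij_betw_iff_bijections)
    then have "atom_of A.C A.cle X" using order_iso_atom[OF F X(1)] B.atoms_cls r by auto
    then obtain s where "s \<in> S1" "X = A.cls s" using A.atoms_cls by blast
    then show ?thesis using X \<phi> B.cls_simple_inj r by (metis image_eqI)
  qed
  then have bij: "bij_betw \<phi> S1 S2" using inj \<phi> unfolding bij_betw_def by blast
  have "cox_m W2 (\<phi> s) (\<phi> t) = cox_m W1 s t \<and> ((s, t) \<in> D1 \<longleftrightarrow> (\<phi> s, \<phi> t) \<in> D2)"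
    if st: "s \<in> S1" "t \<in> S1" for s t
  proof (cases "s = t")
    case True
    \<comment> \<open>Sides give information on distinct atoms; on the diagonal the labels are 1 and
      there are no loops.\<close>
    then show ?thesis using A.cox_m_self B.cox_m_self A.D_S B.D_S \<phi>(1) st by metis
  next
    case False
    then have ne: "\<phi> s \<noteq> \<phi> t" using inj st by (auto simp: inj_on_def)
    have side: "card (side B.C B.cle (B.cls (\<phi> a)) (B.cls (\<phi> b))) = card (side A.C A.cle (A.cls a) (A.cls b))"
      if "a \<in> S1" "b \<in> S1" for a b
      using order_iso_card_side[OF F AC AC] \<phi>(2) that by metis
    show ?thesis
      using A.cox_m_side[OF st False] B.cox_m_side[OF \<phi>(1) \<phi>(1) ne] A.D_side[OF st False]
        B.D_side[OF \<phi>(1) \<phi>(1) ne] side st by simp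
  qed
  then have "diagram_iso W1 S1 D1 W2 S2 D2 \<phi>" using bij unfolding diagram_iso_def by simp
  then show ?thesis using that \<phi>(2) by blast
qed

lemma diagram_anti_iso_converse:
  "diagram_anti_iso W1 S1 D1 W2 S2 D2 \<phi> \<longleftrightarrow> diagram_iso W1 S1 D1 W2 S2 (D2\<inverse>) \<phi>"
  by (simp add: diagram_anti_iso_def diagram_iso_def)

theorem theorem3p5:
  fixes W1 :: "'a monoid" and S1 :: "'a set" and D1 :: "('a \<times> 'a) set"
    and W2 :: "'b monoid" and S2 :: "'b set" and D2 :: "('b \<times> 'b) set"
  assumes "finite_coxeter_system W1 S1" and "finite_coxeter_system W2 S2"
    and "orientation W1 S1 D1" and "orientation W2 S2 D2"
  shows
    "(\<forall>\<phi>. diagram_iso W1 S1 D1 W2 S2 D2 \<phi> \<longrightarrow>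
        (\<exists>F. order_iso (cambrian_carrier W1 S1 D1) (cambrian_le W1 S1 D1)
                        (cambrian_carrier W2 S2 D2) (cambrian_le W2 S2 D2) F \<and>
             (\<forall>s\<in>S1. F (cambrian_class W1 S1 D1 s) = cambrian_class W2 S2 D2 (\<phi> s))))
   \<and> (\<forall>\<phi>. diagram_anti_iso W1 S1 D1 W2 S2 D2 \<phi> \<longrightarrow>
        (\<exists>F. order_anti_iso (cambrian_carrier W1 S1 D1) (cambrian_le W1 S1 D1)
                        (cambrian_carrier W2 S2 D2) (cambrian_le W2 S2 D2) F \<and>
             (\<forall>s\<in>S1. F (cambrian_class W1 S1 D1 s)
                       = cambrian_class W2 S2 D2 (\<phi> s \<otimes>\<^bsub>W2\<^esub> longest W2 S2))))
   \<and> (\<forall>F. order_iso (cambrian_carrier W1 S1 D1) (cambrian_le W1 S1 D1)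
                     (cambrian_carrier W2 S2 D2) (cambrian_le W2 S2 D2) F \<longrightarrow>
        (\<exists>\<phi>. diagram_iso W1 S1 D1 W2 S2 D2 \<phi> \<and>
             (\<forall>s\<in>S1. F (cambrian_class W1 S1 D1 s) = cambrian_class W2 S2 D2 (\<phi> s))))
   \<and> (\<forall>F. order_anti_iso (cambrian_carrier W1 S1 D1) (cambrian_le W1 S1 D1)
                     (cambrian_carrier W2 S2 D2) (cambrian_le W2 S2 D2) F \<longrightarrow>
        (\<exists>\<phi>. diagram_anti_iso W1 S1 D1 W2 S2 D2 \<phi> \<and>
             (\<forall>s\<in>S1. F (cambrian_class W1 S1 D1 s)
                       = cambrian_class W2 S2 D2 (\<phi> s \<otimes>\<^bsub>W2\<^esub> longest W2 S2))))"
proof -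
  have A: "cambrian W1 S1 D1" and B: "cambrian W2 S2 D2"
    using assms finite_coxeterI by (auto simp: cambrian_def cambrian_axioms_def)
  interpret A: cambrian W1 S1 D1 by fact
  interpret B: cambrian W2 S2 D2 by fact
  interpret R: cambrian W2 S2 "D2\<inverse>" by (rule B.cambrian_converse)
  let ?G = "\<lambda>X. (\<lambda>w. w \<otimes>\<^bsub>W2\<^esub> longest W2 S2) ` X"
  note G = B.w0_cambrian_anti_iso
  note Giso = G(1)[unfolded order_anti_iso_converse]
  have bG: "bij_betw ?G R.C B.C" using G(1) unfolding order_anti_iso_def by blast
  show ?thesis
  proof (intro conjI allI impI)
    fix \<phi> assume "diagram_iso W1 S1 D1 W2 S2 D2 \<phi>"
    then show "\<exists>F. order_iso A.C A.cle B.C B.cle F \<and> (\<forall>s\<in>S1. F (A.cls s) = B.cls (\<phi> s))"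
      using diagram_iso_cambrian_iso[OF A B] by metis
  next
    fix \<phi> assume "diagram_anti_iso W1 S1 D1 W2 S2 D2 \<phi>"
    then have \<phi>: "diagram_iso W1 S1 D1 W2 S2 (D2\<inverse>) \<phi>" by (simp only: diagram_anti_iso_converse)
    \<comment> \<open>The map goes through the lattice of the opposite orientation, followed by
      multiplication by \<open>w0\<close>; this is how an atom \<open>s\<close> arrives at the class
      of \<open>\<phi> s w0\<close>.\<close>
    obtain F where F: "order_iso A.C A.cle R.C R.cle F" "\<And>s. s \<in> S1 \<Longrightarrow> F (A.cls s) = R.cls (\<phi> s)"
      using diagram_iso_cambrian_iso[OF A R.cambrian_axioms \<phi>] by blast
    have "\<phi> s \<in> carrier W2" if "s \<in> S1" for s
      using \<phi> that unfolding diagram_iso_def bij_betw_def by auto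
    then have "(?G \<circ> F) (A.cls s) = B.cls (\<phi> s \<otimes>\<^bsub>W2\<^esub> longest W2 S2)" if "s \<in> S1" for s
      using F(2) G(2) that by simp
    then show "\<exists>F. order_anti_iso A.C A.cle B.C B.cle F \<and>
        (\<forall>s\<in>S1. F (A.cls s) = B.cls (\<phi> s \<otimes>\<^bsub>W2\<^esub> longest W2 S2))"
      using order_iso_comp[OF F(1) Giso] unfolding order_anti_iso_converse by blast
  next
    fix F assume "order_iso A.C A.cle B.C B.cle F"
    then show "\<exists>\<phi>. diagram_iso W1 S1 D1 W2 S2 D2 \<phi> \<and> (\<forall>s\<in>S1. F (A.cls s) = B.cls (\<phi> s))"
      using cambrian_iso_diagram_iso[OF A B] by metis
  next
    fix F assume "order_anti_iso A.C A.cle B.C B.cle F"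
    then have F: "order_iso A.C A.cle B.C (\<lambda>x y. B.cle y x) F" by (simp only: order_anti_iso_converse)
    \<comment> \<open>Undoing the multiplication by \<open>w0\<close> turns \<open>F\<close> into an
      isomorphism onto the lattice of the opposite orientation.\<close>
    let ?H = "inv_into R.C ?G"
    obtain \<phi> where \<phi>: "diagram_iso W1 S1 D1 W2 S2 (D2\<inverse>) \<phi>"
      "\<And>s. s \<in> S1 \<Longrightarrow> (?H \<circ> F) (A.cls s) = R.cls (\<phi> s)"
      using cambrian_iso_diagram_iso[OF A R.cambrian_axioms
          order_iso_comp[OF F order_iso_inverse[OF Giso]]] by blast
    have "F (A.cls s) = B.cls (\<phi> s \<otimes>\<^bsub>W2\<^esub> longest W2 S2)" if s: "s \<in> S1" for s
    proof -
      have "F (A.cls s) \<in> B.C" using F s A.C_cls unfolding order_iso_def bij_betw_def by auto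
      then have "F (A.cls s) = ?G (?H (F (A.cls s)))" using bG by (simp add: bij_betw_inv_into_right)
      also have "\<dots> = ?G (R.cls (\<phi> s))" using \<phi>(2) s by simp
      also have "\<dots> = B.cls (\<phi> s \<otimes>\<^bsub>W2\<^esub> longest W2 S2)"
        using \<phi>(1) s by (intro G(2) B.S_closed) (auto simp: diagram_iso_def bij_betw_def)
      finally show ?thesis .
    qed
    then show "\<exists>\<phi>. diagram_anti_iso W1 S1 D1 W2 S2 D2 \<phi> \<and>
        (\<forall>s\<in>S1. F (A.cls s) = B.cls (\<phi> s \<otimes>\<^bsub>W2\<^esub> longest W2 S2))"
      using \<phi>(1) unfolding diagram_anti_iso_converse by blast
  qed
qed

end
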